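(* Let $b\ge 2$ be an integer. For almost every $\alpha\in(1,2)$ (with respect to Lebesgue measure), with type III base $b$ continued logarithm terms $1,c_1b^{a_1},c_2b^{a_2},\dots$, we have $$\lim_{N\to\infty}\left(\prod_{n=1}^N (c_nb^{a_n})\right)^{1/N}=b^{\mathcal{A}_b},$$ where $$\mathcal{A}_b=\frac{1}{\log b\,\log\frac{b+1}{2b}}\sum_{\ell=2}^b\log\left(1-\frac1\ell\right)\log\left(1+\frac1\ell\right).$$
   Context: Fix an integer base $b\ge 2$. For real $\alpha\ge 1$, the type III base $b$ continued logarithm for $\alpha$ is defined by the recursion $y_0=\alpha$, and for $n\ge 0$: $a_n=\lfloor \log_b y_n\rfloor$, $c_n=\lfloor y_n/b^{a_n}\rfloor$; if $y_n=c_nb^{a_n}$ the process terminates; otherwise $y_{n+1}=\dfrac{b^{a_n}}{y_n-c_nb^{a_n}}$. The terms of the continued logarithm are the numbers $c_nb^{a_n}$. (Thus $a_n\in\mathbb{Z}_{\ge 0}$, $c_n\in\{1,\dots,b-1\}$; the process is infinite for irrational $\alpha$; for $\alpha\in(1,2)$ one has $c_0b^{a_0}=1$.) *)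

theory Defs
  imports "HOL-Analysis.Analysis"
begin

definition clog_exp :: "nat \<Rightarrow> real \<Rightarrow> int" where
  "clog_exp b y = \<lfloor>log (real b) y\<rfloor>"

definition clog_coeff :: "nat \<Rightarrow> real \<Rightarrow> int" where
  "clog_coeff b y = \<lfloor>y / real b powi clog_exp b y\<rfloor>"

text \<open>
  The tails \<open>y\<^sub>n\<close> of the type III base \<open>b\<close> continued logarithm of \<open>\<alpha>\<close>, as a total function.
  Once the process has stopped (see \<open>clog_terminates\<close>) the value \<open>clog_tail b \<alpha> n\<close>, which then
  stems from a division by \<open>0\<close>, has no meaning.
\<close>

primrec clog_tail :: "nat \<Rightarrow> real \<Rightarrow> nat \<Rightarrow> real" where
  "clog_tail b \<alpha> 0 = \<alpha>"
| "clog_tail b \<alpha> (Suc n) =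
     (let y = clog_tail b \<alpha> n; a = clog_exp b y; c = clog_coeff b y
      in real b powi a / (y - of_int c * real b powi a))"

definition clog_a :: "nat \<Rightarrow> real \<Rightarrow> nat \<Rightarrow> int" where
  "clog_a b \<alpha> n = clog_exp b (clog_tail b \<alpha> n)"

definition clog_c :: "nat \<Rightarrow> real \<Rightarrow> nat \<Rightarrow> int" where
  "clog_c b \<alpha> n = clog_coeff b (clog_tail b \<alpha> n)"

definition clog_term :: "nat \<Rightarrow> real \<Rightarrow> nat \<Rightarrow> real" where
  "clog_term b \<alpha> n = of_int (clog_c b \<alpha> n) * real b powi clog_a b \<alpha> n"

text \<open>
  The first \<open>n\<close> with \<open>y\<^sub>n = c\<^sub>n b\<^bsup>a\<^sub>n\<^esup>\<close> is reached before any division by \<open>0\<close>, so the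
  conventions for later indices do not affect whether such an \<open>n\<close> exists.
\<close>

definition clog_terminates :: "nat \<Rightarrow> real \<Rightarrow> bool" where
  "clog_terminates b \<alpha> \<longleftrightarrow> (\<exists>n. clog_tail b \<alpha> n = clog_term b \<alpha> n)"

definition clog_khinchine_exponent :: "nat \<Rightarrow> real" where
  "clog_khinchine_exponent b =
     1 / (ln (real b) * ln ((real b + 1) / (2 * real b))) *
     (\<Sum>l = 2..b. ln (1 - 1 / real l) * ln (1 + 1 / real l))"

end

theory Submission
  imports Defs
begin

text \<open>
  Put \<open>x = \<alpha> - 1\<close>. The reciprocals of the tails \<open>y\<^sub>1, y\<^sub>2, \<dots>\<close> are the orbit of \<open>x\<close> under a Gauss-like map
  \<open>T\<close> of \<open>(0,1)\<close> whose inverse branches are \<open>t \<mapsto> 1 / (b\<^sup>a (c + t))\<close>. Its invariant density is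
  \<open>1 / (1 + x) - 1 / (b + x)\<close>, so by Birkhoff's theorem the averages of the logarithms of the terms converge to the mean of
  the logarithm of the first term, which telescopes. Ergodicity comes from bounded distortion: for a cylinder of any rank,
  the conditional law of \<open>T\<^sup>n x\<close> for uniform \<open>x\<close> has a density proportional to \<open>1 / (1 + w t)\<^sup>2\<close> with \<open>w \<in> [0,1]\<close>, hence an
  invariant set of positive measure fills a fixed proportion of every open set.
\<close>

section \<open>Birkhoff's theorem for ergodic maps\<close>

text \<open>Cylinders of higher rank never appear as sets. The distortion estimate is an induction
  over an inequality quantified over all weights \<open>clog_weight w\<close> with w in [0,1] and
  all test functions that are Lipschitz for the logarithmic distance. One application of the inverse
  branches composes the test function with them, halves its Lipschitz constant and leads back to
  weights of the same family. The defect of the inequality is proportional to the Lipschitz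
  constant, so it disappears as the number of steps grows. Approximation of open sets by Lipschitz
  functions and outer regularity then take the place of an argument with density points. The measure
  stays unnormalised, with mass ln (2 b / (b + 1)). Up to sign this is the factor ln ((b + 1) / (2
  b)) in the exponent, the sum over l is the integral of the logarithm of a term, and 1 / ln b
  converts natural logarithms to base b.\<close>

definition birkhoff_sum :: "('a \<Rightarrow> 'a) \<Rightarrow> ('a \<Rightarrow> real) \<Rightarrow> nat \<Rightarrow> 'a \<Rightarrow> real" where
  "birkhoff_sum T g n x = (\<Sum>i<n. g ((T ^^ i) x))"

lemma birkhoff_sum_Suc: "birkhoff_sum T g (Suc n) x = g x + birkhoff_sum T g n (T x)"
  unfolding birkhoff_sum_def by (simp only: sum.lessThan_Suc_shift funpow_Suc_right) simp

lemma birkhoff_sum_0 [simp]: "birkhoff_sum T g 0 x = 0"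
  by (simp add: birkhoff_sum_def)

lemma birkhoff_sum_measurable [measurable]:
  assumes [measurable]: "T \<in> measurable M M" "g \<in> borel_measurable M"
  shows "birkhoff_sum T g n \<in> borel_measurable M"
  unfolding birkhoff_sum_def by measurable

text \<open>The recursion computes \<open>max {0, S\<^sub>1 g, \<dots>, S\<^sub>n g}\<close>, since \<open>S\<^sub>k\<^sub>+\<^sub>1 g = g + S\<^sub>k g \<circ> T\<close>.\<close>

primrec birkhoff_max :: "('a \<Rightarrow> 'a) \<Rightarrow> ('a \<Rightarrow> real) \<Rightarrow> nat \<Rightarrow> 'a \<Rightarrow> real" where
  "birkhoff_max T g 0 = (\<lambda>x. 0)"
| "birkhoff_max T g (Suc n) = (\<lambda>x. max 0 (g x + birkhoff_max T g n (T x)))"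

lemma birkhoff_max_nonneg: "0 \<le> birkhoff_max T g n x"
  by (cases n) auto

lemma birkhoff_max_Suc_mono: "birkhoff_max T g n x \<le> birkhoff_max T g (Suc n) x"
proof (induction n arbitrary: x)
  case (Suc n)
  show ?case using Suc[of "T x"] by (auto simp: max_def)
qed simp

lemma birkhoff_max_mono: "m \<le> n \<Longrightarrow> birkhoff_max T g m x \<le> birkhoff_max T g n x"
  using lift_Suc_mono_le[of "\<lambda>n. birkhoff_max T g n x"] birkhoff_max_Suc_mono by metis

lemma birkhoff_sum_le_max: "birkhoff_sum T g n x \<le> birkhoff_max T g n x"
proof (induction n arbitrary: x)
  case (Suc n)
  show ?case using Suc[of "T x"] by (auto simp: birkhoff_sum_Suc)
qed simp

locale measure_preserving =
  fixes M :: "'a measure" and T :: "'a \<Rightarrow> 'a"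
  assumes T_measurable [measurable]: "T \<in> measurable M M"
    and distr_T: "distr M M T = M"
begin

lemma integrable_comp: "integrable M (\<lambda>x. g (T x))" if "integrable M g" for g :: "'a \<Rightarrow> real"
  using integrable_distr[of T M M g] that by (simp add: distr_T)

lemma integral_comp: "(\<integral>x. g (T x) \<partial>M) = integral\<^sup>L M g" if [measurable]: "integrable M g"
  for g :: "'a \<Rightarrow> real"
  using integral_distr[of T M M g] by (simp add: distr_T)

lemma AE_comp: "AE x in M. P (T x)" if "AE x in M. P x"
  using that by (intro AE_distrD[OF T_measurable]) (simp only: distr_T)

lemma AE_funpow: "AE x in M. P ((T ^^ n) x)" if "AE x in M. P x"
  using that
proof (induction n)
  case (Suc n)
  show ?case using AE_comp[OF Suc.IH] Suc.prems by (simp add: funpow_swap1)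
qed simp

lemma integrable_birkhoff_max: "integrable M (birkhoff_max T g n)" if "integrable M g"
proof (induction n)
  case (Suc n)
  then show ?case using that integrable_comp[of "birkhoff_max T g n"] by simp
qed simp

text \<open>Garsia's proof: where \<open>birkhoff_max T g (Suc n)\<close> is positive, it equals \<open>g + birkhoff_max T g n \<circ> T\<close>.\<close>

lemma maximal_ergodic:
  assumes g [measurable]: "integrable M g" and pos: "AE x in M. \<exists>n. birkhoff_sum T g n x > 0"
  shows "integral\<^sup>L M g \<ge> 0"
proof -
  have int: "integrable M (birkhoff_max T g n)" for n
    by (rule integrable_birkhoff_max[OF g])
  have [measurable]: "birkhoff_max T g n \<in> borel_measurable M" for n
    using int[of n] by auto
  define G where "G n x = indicator {x \<in> space M. birkhoff_max T g (Suc n) x > 0} x * g x" for n x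
  have [measurable]: "G n \<in> borel_measurable M" for n unfolding G_def by measurable
  have Gint: "integrable M (G n)" for n
  proof (rule Bochner_Integration.integrable_bound[OF g])
    show "AE x in M. norm (G n x) \<le> norm (g x)" by (auto simp: G_def indicator_def)
  qed measurable
  have nonneg: "integral\<^sup>L M (G n) \<ge> 0" for n
  proof -
    \<comment> \<open>\<open>T\<close> preserves \<open>M\<close>, so a function and its composition
      with \<open>T\<close> have the same integral.\<close>
    have "0 = (\<integral>x. birkhoff_max T g (Suc n) x - birkhoff_max T g (Suc n) (T x) \<partial>M)"
      using int[of "Suc n"] integrable_comp[OF int[of "Suc n"]] integral_comp[OF int[of "Suc n"]]
      by (subst Bochner_Integration.integral_diff) auto
    also have "\<dots> \<le> integral\<^sup>L M (G n)"
    proof (rule integral_mono[OF _ Gint])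
      show "integrable M (\<lambda>x. birkhoff_max T g (Suc n) x - birkhoff_max T g (Suc n) (T x))"
        using int[of "Suc n"] integrable_comp[OF int[of "Suc n"]] by auto
      fix x assume x: "x \<in> space M"
      show "birkhoff_max T g (Suc n) x - birkhoff_max T g (Suc n) (T x) \<le> G n x"
      proof (cases "birkhoff_max T g (Suc n) x > 0")
        case True
        then have "birkhoff_max T g (Suc n) x = g x + birkhoff_max T g n (T x)" by (simp split: if_splits add: max_def)
        moreover have "G n x = g x" using True x by (simp add: G_def del: birkhoff_max.simps)
        ultimately show ?thesis using birkhoff_max_Suc_mono[of T g n "T x"] by linarith
      next
        case False
        then have "G n x = 0" by (simp add: G_def del: birkhoff_max.simps)
        then show ?thesis using False birkhoff_max_nonneg[of T g "Suc n" "T x"] by linarith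
      qed
    qed
    finally show ?thesis .
  qed
  \<comment> \<open>By \<open>pos\<close> almost every point eventually lies in the set where the
    maximum is positive, so \<open>G n\<close> increases its support to everything and the sign
    passes to the limit.\<close>
  have "(\<lambda>n. integral\<^sup>L M (G n)) \<longlonglongrightarrow> integral\<^sup>L M g"
  proof (rule integral_dominated_convergence[where w = "\<lambda>x. \<bar>g x\<bar>"])
    show "integrable M (\<lambda>x. \<bar>g x\<bar>)" using g by auto
    show "AE x in M. norm (G n x) \<le> \<bar>g x\<bar>" for n by (auto simp: G_def indicator_def)
    show "AE x in M. (\<lambda>n. G n x) \<longlonglongrightarrow> g x"
      using pos AE_space
    proof eventually_elim
      case (elim x)
      then obtain k where k: "birkhoff_sum T g k x > 0" by auto
      have "G n x = g x" if "n \<ge> k" for n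
      proof -
        have "birkhoff_max T g (Suc n) x > 0"
          using k birkhoff_sum_le_max[of T g k x] birkhoff_max_mono[of k "Suc n" T g x] that by linarith
        then show ?thesis using elim by (simp add: G_def del: birkhoff_max.simps)
      qed
      then show ?case
        by (intro tendsto_eventually) (auto simp: eventually_sequentially)
    qed
  qed auto
  then show ?thesis by (rule LIMSEQ_le_const) (use nonneg in auto)
qed

end

text \<open>Only strictly invariant sets are tested, not sets invariant up to a null set. This fits
  the use below, where the set of points with unbounded Birkhoff sums is strictly invariant.\<close>

locale ergodic_system = measure_preserving +
  assumes ergodic: "A \<in> sets M \<Longrightarrow> T -` A \<inter> space M = A \<Longrightarrow>
    emeasure M A = 0 \<or> emeasure M (space M - A) = 0"
begin

text \<open>Passing from a point to its image changes the sums by a shift and the single number g x,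
  so unboundedness above is an invariant property. If it held almost everywhere, the maximal ergodic
  theorem would force the integral of g to be nonnegative.\<close>

lemma AE_birkhoff_sum_bdd_above:
  assumes g [measurable]: "integrable M g" and neg: "integral\<^sup>L M g < 0"
  shows "AE x in M. bdd_above (range (\<lambda>n. birkhoff_sum T g n x))"
proof -
  define A where "A = {x \<in> space M. \<forall>K::nat. \<exists>n. birkhoff_sum T g n x > real K}"
  have [measurable]: "A \<in> sets M" unfolding A_def by measurable
  have "T x \<in> A \<longleftrightarrow> x \<in> A" if x: "x \<in> space M" for x
  proof -
    have Tx: "T x \<in> space M" using x T_measurable by (auto simp: measurable_def)
    have "\<exists>n. birkhoff_sum T g n x > real K" if xA: "T x \<in> A" for K
    proof -
      have "real K - g x \<le> real (nat \<lceil>real K - g x\<rceil>)" by linarith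
      moreover obtain n where "birkhoff_sum T g n (T x) > real (nat \<lceil>real K - g x\<rceil>)"
        using xA unfolding A_def by blast
      ultimately have "birkhoff_sum T g (Suc n) x > real K" by (simp add: birkhoff_sum_Suc)
      then show ?thesis ..
    qed
    moreover have "\<exists>n. birkhoff_sum T g n (T x) > real K" if xA: "x \<in> A" for K
    proof -
      have "real K + g x \<le> real (nat \<lceil>real K + g x\<rceil>)" by linarith
      moreover obtain n where n: "birkhoff_sum T g n x > real (nat \<lceil>real K + g x\<rceil>)"
        using xA unfolding A_def by blast
      moreover from n have "n \<noteq> 0" by (cases n) auto
      then obtain m where "n = Suc m" using not0_implies_Suc by blast
      ultimately have "birkhoff_sum T g m (T x) > real K" by (simp add: birkhoff_sum_Suc)
      then show ?thesis ..
    qed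
    ultimately show ?thesis using x Tx by (auto simp: A_def)
  qed
  then have "T -` A \<inter> space M = A" using sets.sets_into_space[of A M] by auto
  then consider "emeasure M A = 0" | "emeasure M (space M - A) = 0"
    using ergodic[of A] by auto
  then show ?thesis
  proof cases
    case 1
    then have "AE x in M. x \<notin> A" by (intro AE_not_in) (auto simp: null_sets_def)
    then show ?thesis using AE_space
    proof eventually_elim
      case (elim x)
      then obtain K :: nat where "\<forall>n. birkhoff_sum T g n x \<le> real K" by (auto simp: A_def not_less)
      then show ?case by (intro bdd_aboveI2) auto
    qed
  next
    case 2
    then have "AE x in M. x \<notin> space M - A" by (intro AE_not_in) (auto simp: null_sets_def)
    then have "AE x in M. \<exists>n. birkhoff_sum T g n x > 0" using AE_space
    proof eventually_elim
      case (elim x)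
      then have "x \<in> A" by blast
      then have "\<exists>n. birkhoff_sum T g n x > real 0" unfolding A_def by blast
      then show ?case by simp
    qed
    then show ?thesis using maximal_ergodic[OF g] neg by simp
  qed
qed

text \<open>Subtracting slightly more than the mean from f, or f from slightly less than the mean,
  yields functions of negative integral. Their Birkhoff sums are bounded above, and after division
  by n these bounds enclose the averages within every 1 / (k + 1) of the mean in the limit.\<close>

lemma birkhoff:
  assumes fin: "finite_measure M" and pos: "measure M (space M) > 0"
    and f [measurable]: "integrable M f"
  shows "AE x in M. (\<lambda>n. birkhoff_sum T f n x / real n) \<longlonglongrightarrow> integral\<^sup>L M f / measure M (space M)"
proof -
  interpret finite_measure M by fact
  define m where "m = integral\<^sup>L M f / measure M (space M)"
  have m: "integral\<^sup>L M f = m * measure M (space M)" using pos by (simp add: m_def)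
  have sum_diff: "birkhoff_sum T (\<lambda>x. f x - r) n x = birkhoff_sum T f n x - n * r" for r n x
    by (simp add: birkhoff_sum_def sum_subtractf)
  have sum_diff': "birkhoff_sum T (\<lambda>x. r - f x) n x = n * r - birkhoff_sum T f n x" for r n x
    by (simp add: birkhoff_sum_def sum_subtractf)
  have "AE x in M. bdd_above (range (\<lambda>n. birkhoff_sum T (\<lambda>x. f x - (m + 1 / Suc k)) n x))" for k
    by (rule AE_birkhoff_sum_bdd_above) (use f pos in \<open>auto simp: m algebra_simps zero_less_mult_iff zero_less_divide_iff\<close>)
  moreover have "AE x in M. bdd_above (range (\<lambda>n. birkhoff_sum T (\<lambda>x. (m - 1 / Suc k) - f x) n x))" for k
    by (rule AE_birkhoff_sum_bdd_above) (use f pos in \<open>auto simp: m algebra_simps zero_less_mult_iff zero_less_divide_iff\<close>)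
  ultimately have "AE x in M. \<forall>k. bdd_above (range (\<lambda>n. birkhoff_sum T (\<lambda>x. f x - (m + 1 / Suc k)) n x))
      \<and> bdd_above (range (\<lambda>n. birkhoff_sum T (\<lambda>x. (m - 1 / Suc k) - f x) n x))"
    by (subst AE_all_countable) auto
  then show ?thesis
  proof eventually_elim
    case (elim x)
    show ?case unfolding m_def[symmetric]
    proof (rule LIMSEQ_I)
      fix e :: real assume e: "e > 0"
      then obtain k where k: "1 / real (Suc k) < e / 2"
        using nat_approx_posE[of "e/2"] by auto
      obtain K1 where K1: "birkhoff_sum T f n x - n * (m + 1 / Suc k) \<le> K1" for n
        using elim[rule_format, of k] unfolding sum_diff by (auto simp: bdd_above_def)
      obtain K2 where K2: "n * (m - 1 / Suc k) - birkhoff_sum T f n x \<le> K2" for n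
        using elim[rule_format, of k] unfolding sum_diff' by (auto simp: bdd_above_def)
      define K where "K = max K1 K2"
      obtain N :: nat where N: "real N > 2 * K / e" using reals_Archimedean2 by blast
      have "norm (birkhoff_sum T f n x / n - m) < e" if n: "n \<ge> max N 1" for n
      proof -
        have n0: "real n > 0" using n by simp
        have "real n > 2 * K / e" using N n by simp
        then have Kn: "K / n < e / 2" using e n0 by (simp add: field_simps)
        define d where "d = 1 / real (Suc k)"
        have "birkhoff_sum T f n x - n * (m + d) \<le> K" using K1[of n] by (simp add: K_def d_def)
        then have "birkhoff_sum T f n x / n \<le> (K + n * (m + d)) / n"
          using n0 by (intro divide_right_mono) auto
        then have "birkhoff_sum T f n x / n - m \<le> K / n + d"
          using n0 by (simp add: add_divide_distrib)
        moreover have "n * (m - d) - birkhoff_sum T f n x \<le> K" using K2[of n] by (simp add: K_def d_def)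
        then have "(n * (m - d) - K) / n \<le> birkhoff_sum T f n x / n"
          using n0 by (intro divide_right_mono) auto
        then have "m - birkhoff_sum T f n x / n \<le> K / n + d"
          using n0 by (simp add: diff_divide_distrib)
        ultimately show ?thesis using Kn k unfolding real_norm_def d_def[symmetric] by linarith
      qed
      then show "\<exists>no. \<forall>n\<ge>no. norm (birkhoff_sum T f n x / n - m) < e" by blast
    qed
  qed
qed

end

section \<open>The invariant measure\<close>

definition clog_map :: "nat \<Rightarrow> real \<Rightarrow> real" where
  "clog_map b x = 1 / x / real b powi clog_exp b (1 / x) - of_int (clog_coeff b (1 / x))"

definition clog_branch :: "nat \<Rightarrow> nat \<Rightarrow> nat \<Rightarrow> real \<Rightarrow> real" where
  "clog_branch b a c t = 1 / (real b ^ a * (real c + t))"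

text \<open>Absolute value of the derivative of \<open>clog_branch b a c\<close>; the branches are
  decreasing.\<close>

definition clog_jac :: "nat \<Rightarrow> nat \<Rightarrow> nat \<Rightarrow> real \<Rightarrow> real" where
  "clog_jac b a c t = 1 / (real b ^ a * (real c + t)\<^sup>2)"

definition clog_density :: "nat \<Rightarrow> real \<Rightarrow> real" where
  "clog_density b x = 1 / (1 + x) - 1 / (real b + x)"

definition clog_measure :: "nat \<Rightarrow> real measure" where
  "clog_measure b = density lborel (\<lambda>x. ennreal (clog_density b x) * indicator {0<..<1} x)"

section \<open>Measurability\<close>

lemma powi_measurable [measurable]:
  fixes x :: real
  assumes [measurable]: "k \<in> measurable M (count_space UNIV)"
  shows "(\<lambda>y. x powi k y) \<in> borel_measurable M"
  by (rule measurable_compose[OF assms]) simp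

lemma clog_exp_measurable [measurable]: "clog_exp b \<in> measurable borel (count_space UNIV)"
  unfolding clog_exp_def by measurable

lemma clog_coeff_measurable [measurable]: "clog_coeff b \<in> measurable borel (count_space UNIV)"
  unfolding clog_coeff_def by measurable

lemma clog_map_measurable [measurable]: "clog_map b \<in> borel_measurable borel"
  unfolding clog_map_def by measurable

lemma clog_branch_measurable [measurable]: "clog_branch b a c \<in> borel_measurable borel"
  unfolding clog_branch_def by measurable

lemma clog_jac_measurable [measurable]: "clog_jac b a c \<in> borel_measurable borel"
  unfolding clog_jac_def by measurable

lemma clog_density_measurable [measurable]: "clog_density b \<in> borel_measurable borel"
  unfolding clog_density_def by measurable

lemma sets_clog_measure [measurable_cong, simp]: "sets (clog_measure b) = sets borel"
  by (simp add: clog_measure_def)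

lemma space_clog_measure [simp]: "space (clog_measure b) = UNIV"
  by (simp add: clog_measure_def)

section \<open>Digits and inverse branches\<close>

lemma clog_digits:
  assumes b: "b \<ge> 2" and c: "c \<in> {1..<b}"
    and y: "real c * real b ^ a \<le> y" "y < (real c + 1) * real b ^ a"
  shows "clog_exp b y = int a" "clog_coeff b y = int c"
proof -
  have b0: "real b > 1" "real b ^ a > 0" using b by auto
  have "1 * real b ^ a \<le> real c * real b ^ a" using c b0 by (intro mult_right_mono) auto
  then have lower: "real b ^ a \<le> y" using y by simp
  have "(real c + 1) * real b ^ a \<le> real b * real b ^ a" using c b0 by (intro mult_right_mono) auto
  then have upper: "y < real b ^ a * real b" using y by (simp add: mult.commute)
  have "y > 0" using lower b0 by linarith
  have "\<lfloor>log (real b) y\<rfloor> = int a"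
    using lower upper b0 \<open>y > 0\<close> by (subst floor_log_eq_powr_iff) (auto simp: powr_realpow powr_add)
  then show e: "clog_exp b y = int a" by (simp add: clog_exp_def)
  have "real c \<le> y / real b ^ a" "y / real b ^ a < real c + 1"
    using y b0 by (auto simp: field_simps)
  then have "\<lfloor>y / real b ^ a\<rfloor> = int c" by (intro floor_unique) auto
  then show "clog_coeff b y = int c" by (simp add: clog_coeff_def e)
qed

text \<open>The intervals from c b^a to (c + 1) b^a, closed on the left and open on the right, tile
  the half-line from 1 on. This is the covering half; \<open>clog_digits\<close> gives disjointness,
  since it recovers a and c from a point of the interval.\<close>

lemma clog_digits_exist:
  assumes b: "b \<ge> 2" and y: "y \<ge> 1"
  obtains a c where "c \<in> {1..<b}" "real c * real b ^ a \<le> y" "y < (real c + 1) * real b ^ a"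
proof -
  define a where "a = nat \<lfloor>log (real b) y\<rfloor>"
  have b0: "real b > 1" "real b ^ a > 0" using b by auto
  have "log (real b) y \<ge> 0" using b0 y by (simp add: zero_le_log_cancel_iff)
  then have "\<lfloor>log (real b) y\<rfloor> = int a" by (simp add: a_def)
  then have a: "real b ^ a \<le> y" "y < real b * real b ^ a"
    using b0 y by (auto simp: floor_log_eq_powr_iff powr_realpow powr_add mult.commute)
  define c where "c = nat \<lfloor>y / real b ^ a\<rfloor>"
  have yb: "y / real b ^ a \<ge> 1" "y / real b ^ a < real b" using a b0 by (auto simp: field_simps)
  have cy: "real c \<le> y / real b ^ a" "y / real b ^ a < real c + 1"
    using yb by (auto simp: c_def)
  have "real c < real b" "real c + 1 > 1" using cy yb by linarith+
  then have "c \<in> {1..<b}" by auto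
  moreover have "real c * real b ^ a \<le> y" "y < (real c + 1) * real b ^ a"
    using cy b0 by (auto simp: field_simps)
  ultimately show ?thesis using that by blast
qed

lemma clog_branch_inverse:
  assumes b: "b \<ge> 2" and c: "c \<in> {1..<b}" and t: "0 \<le> t" "t < 1"
  shows "clog_exp b (1 / clog_branch b a c t) = int a"
    and "clog_coeff b (1 / clog_branch b a c t) = int c"
    and "clog_map b (clog_branch b a c t) = t"
proof -
  have b0: "real b ^ a > 0" using b by auto
  have y: "1 / clog_branch b a c t = (real c + t) * real b ^ a" by (simp add: clog_branch_def)
  show e: "clog_exp b (1 / clog_branch b a c t) = int a" "clog_coeff b (1 / clog_branch b a c t) = int c"
    unfolding y by (rule clog_digits[OF b c, of a]; use t b0 in simp)+
  show "clog_map b (clog_branch b a c t) = t"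
    unfolding clog_map_def e unfolding y using b0 by simp
qed

lemma clog_branch_bounds:
  assumes b: "b \<ge> 2" and c: "c \<in> {1..<b}" and t: "0 < t"
  shows "clog_branch b a c t > 0" "clog_branch b a c t < 1"
proof -
  have "real b ^ a \<ge> 1" "real c + t > 1" using b c t by auto
  then have "real b ^ a * (real c + t) > 1"
    by (smt (verit) mult_le_cancel_right1)
  then show "clog_branch b a c t > 0" "clog_branch b a c t < 1" by (auto simp: clog_branch_def)
qed

text \<open>Reciprocals of the intervals of constant digits are the cylinders of rank one, now open
  on the left; exactly one pair of digits contributes. The form as a sum of indicators is the one
  needed for splitting an integral.\<close>

lemma suminf_clog_cylinders:
  assumes b: "b \<ge> 2" and x: "0 < x" "x \<le> 1"
  shows "(\<Sum>c\<in>{1..<b}. \<Sum>a. indicator {1 / (real b ^ a * (real c + 1)) <.. 1 / (real b ^ a * real c)} x) = (1 :: ennreal)"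
proof -
  have "1 / x \<ge> 1" using x by simp
  then obtain a0 c0 where d: "c0 \<in> {1..<b}" "real c0 * real b ^ a0 \<le> 1 / x" "1 / x < (real c0 + 1) * real b ^ a0"
    using clog_digits_exist[OF b] by metis
  have ind: "indicator {1 / (real b ^ a * (real c + 1)) <.. 1 / (real b ^ a * real c)} x
      = (if a = a0 then if c = c0 then 1 else 0 else 0 :: ennreal)" if c: "c \<in> {1..<b}" for a c
  proof -
    have b0: "real b ^ a > 0" using b by auto
    have "x \<in> {1 / (real b ^ a * (real c + 1)) <.. 1 / (real b ^ a * real c)} \<longleftrightarrow>
        real c * real b ^ a \<le> 1 / x \<and> 1 / x < (real c + 1) * real b ^ a"
    proof -
      have "x > 1 / (real b ^ a * (real c + 1)) \<longleftrightarrow> 1 / x < (real c + 1) * real b ^ a"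
        using x b0 c by (subst (1 2) divide_less_eq) (auto simp: mult_ac)
      moreover have "x \<le> 1 / (real b ^ a * real c) \<longleftrightarrow> real c * real b ^ a \<le> 1 / x"
        using x b0 c by (subst (1 2) le_divide_eq) (auto simp: mult_ac)
      ultimately show ?thesis by auto
    qed
    also have "\<dots> \<longleftrightarrow> a = a0 \<and> c = c0"
      using clog_digits[OF b c, of a "1 / x"] clog_digits[OF b d] d by auto
    finally show ?thesis by (auto simp: indicator_def)
  qed
  have "(\<Sum>a. if a = a0 then if c = c0 then 1 else 0 else 0) = (if c = c0 then 1 else 0 :: ennreal)" for c
    using suminf_finite[of "{a0}" "\<lambda>a. if a = a0 then if c = c0 then 1 else 0 else 0 :: ennreal"] by simp
  then show ?thesis using d(1) by (simp add: ind)
qed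

section \<open>Change of variables along the inverse branches\<close>

lemma nn_integral_clog_branch:
  fixes g :: "real \<Rightarrow> ennreal"
  assumes b: "b \<ge> 2" and c: "c \<in> {1..<b}" and [measurable]: "g \<in> borel_measurable borel"
  shows "(\<integral>\<^sup>+x. g x * indicator {1 / (real b ^ a * (real c + 1)) <.. 1 / (real b ^ a * real c)} x \<partial>lborel)
    = (\<integral>\<^sup>+t. g (clog_branch b a c t) * ennreal (clog_jac b a c t) * indicator {0<..<1} t \<partial>lborel)"
proof -
  have b0: "real b ^ a > 0" using b by auto
  \<comment> \<open>The substitution rule wants a nonnegative derivative, but the branch decreases.
    Hence the parameter 1 - x, undone afterwards by an affine substitution; the end points are null
    sets.\<close>
  have "(\<integral>\<^sup>+x. g x * indicator {1 / (real b ^ a * (real c + 1)) <.. 1 / (real b ^ a * real c)} x \<partial>lborel) =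
    (\<integral>\<^sup>+x. g x * indicator {clog_branch b a c (1 - 0)..clog_branch b a c (1 - 1)} x \<partial>lborel)"
  proof (rule nn_integral_cong_AE)
    have "AE x in lborel. x \<noteq> 1 / (real b ^ a * (real c + 1))" by (rule AE_lborel_singleton)
    then show "AE x in lborel. g x * indicator {1 / (real b ^ a * (real c + 1)) <.. 1 / (real b ^ a * real c)} x =
        g x * indicator {clog_branch b a c (1 - 0)..clog_branch b a c (1 - 1)} x"
      by eventually_elim (auto simp: clog_branch_def indicator_def)
  qed
  also have "\<dots> = (\<integral>\<^sup>+x. g (clog_branch b a c (1 - x)) * ennreal (clog_jac b a c (1 - x)) * indicator {0..1} x \<partial>lborel)"
  proof (rule nn_integral_substitution_aux)
    fix x :: real assume x: "x \<in> {0..1}"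
    have "real c + (1 - x) > 0" using c x by auto
    then show "((\<lambda>x. clog_branch b a c (1 - x)) has_real_derivative clog_jac b a c (1 - x)) (at x)"
      unfolding clog_branch_def clog_jac_def using b0
      by (auto intro!: derivative_eq_intros simp: divide_simps power2_eq_square)
    show "clog_jac b a c (1 - x) \<ge> 0" by (simp add: clog_jac_def)
  next
    show "continuous_on {0..1} (\<lambda>x. clog_jac b a c (1 - x))"
      unfolding clog_jac_def using b0 c by (intro continuous_intros) auto
  qed auto
  also have "\<dots> = (\<integral>\<^sup>+t. g (clog_branch b a c t) * ennreal (clog_jac b a c t) * indicator {0..1} t \<partial>lborel)"
    by (subst nn_integral_real_affine[where t = 1 and c = "-1"])
       (auto intro!: nn_integral_cong simp: indicator_def)
  also have "\<dots> = (\<integral>\<^sup>+t. g (clog_branch b a c t) * ennreal (clog_jac b a c t) * indicator {0<..<1} t \<partial>lborel)"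
  proof (rule nn_integral_cong_AE)
    have "AE x::real in lborel. x \<noteq> 0" "AE x::real in lborel. x \<noteq> 1" by (auto intro: AE_lborel_singleton)
    then show "AE t in lborel. g (clog_branch b a c t) * ennreal (clog_jac b a c t) * indicator {0..1} t =
        g (clog_branch b a c t) * ennreal (clog_jac b a c t) * indicator {0<..<1} t"
      by eventually_elim (auto simp: indicator_def)
  qed
  finally show ?thesis .
qed

lemma nn_integral_sum_suminf:
  fixes f :: "'i \<Rightarrow> nat \<Rightarrow> 'a \<Rightarrow> ennreal"
  assumes [measurable]: "\<And>i n. f i n \<in> borel_measurable M"
  shows "(\<integral>\<^sup>+x. (\<Sum>i\<in>I. \<Sum>n. f i n x) \<partial>M) = (\<Sum>i\<in>I. \<Sum>n. \<integral>\<^sup>+x. f i n x \<partial>M)"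
  by (subst nn_integral_sum, measurable, intro sum.cong refl nn_integral_suminf, measurable)

text \<open>The common source of the invariance of the measure, the distortion estimate and the mean
  of the logarithm: each arises from a different choice of g.\<close>

lemma nn_integral_clog_branches:
  fixes g :: "real \<Rightarrow> ennreal"
  assumes b: "b \<ge> 2" and [measurable]: "g \<in> borel_measurable borel"
  shows "(\<integral>\<^sup>+x. g x * indicator {0<..<1} x \<partial>lborel) =
    (\<Sum>c\<in>{1..<b}. \<Sum>a. \<integral>\<^sup>+t. g (clog_branch b a c t) * ennreal (clog_jac b a c t) * indicator {0<..<1} t \<partial>lborel)"
proof -
  have "(\<integral>\<^sup>+x. g x * indicator {0<..<1} x \<partial>lborel) = (\<integral>\<^sup>+x. (\<Sum>c\<in>{1..<b}. \<Sum>a.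
      g x * indicator {1 / (real b ^ a * (real c + 1)) <.. 1 / (real b ^ a * real c)} x) \<partial>lborel)"
  proof (rule nn_integral_cong_AE)
    have "AE x::real in lborel. x \<noteq> 1" by (rule AE_lborel_singleton)
    then show "AE x in lborel. g x * indicator {0<..<1} x = (\<Sum>c\<in>{1..<b}. \<Sum>a.
        g x * indicator {1 / (real b ^ a * (real c + 1)) <.. 1 / (real b ^ a * real c)} x)"
    proof eventually_elim
      case (elim x)
      have "(\<Sum>c\<in>{1..<b}. \<Sum>a. g x * indicator {1 / (real b ^ a * (real c + 1)) <.. 1 / (real b ^ a * real c)} x)
        = g x * (\<Sum>c\<in>{1..<b}. \<Sum>a. indicator {1 / (real b ^ a * (real c + 1)) <.. 1 / (real b ^ a * real c)} x)"
        by (simp add: sum_distrib_left)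
      also have "\<dots> = g x * indicator {0<..<1} x"
      proof (cases "x \<in> {0<..<1}")
        case True
        then show ?thesis using suminf_clog_cylinders[OF b, of x] by (simp del: One_nat_def)
      next
        case False
        have "indicator {1 / (real b ^ a * (real c + 1)) <.. 1 / (real b ^ a * real c)} x = (0::ennreal)"
          if c: "c \<in> {1..<b}" for a c
        proof -
          have "real b ^ a * real c \<ge> 1 * 1" using b c by (intro mult_mono) auto
          then have "1 / (real b ^ a * real c) \<le> 1" by (simp add: divide_simps)
          moreover have "1 / (real b ^ a * (real c + 1)) \<ge> 0" by simp
          ultimately show ?thesis using False elim
            by (smt (verit) greaterThanAtMost_iff greaterThanLessThan_iff indicator_simps(2))
        qed
        then show ?thesis using False by simp
      qed
      finally show ?case ..
    qed
  qed
  also have "\<dots> = (\<Sum>c\<in>{1..<b}. \<Sum>a.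
      \<integral>\<^sup>+x. g x * indicator {1 / (real b ^ a * (real c + 1)) <.. 1 / (real b ^ a * real c)} x \<partial>lborel)"
    by (rule nn_integral_sum_suminf) measurable
  also have "\<dots> = (\<Sum>c\<in>{1..<b}. \<Sum>a.
      \<integral>\<^sup>+t. g (clog_branch b a c t) * ennreal (clog_jac b a c t) * indicator {0<..<1} t \<partial>lborel)"
    using nn_integral_clog_branch[OF b] by (intro sum.cong refl suminf_cong) auto
  finally show ?thesis .
qed

section \<open>Invariance of the density\<close>

lemma clog_density_pos:
  assumes "b \<ge> 2" "x \<ge> 0"
  shows "clog_density b x > 0"
  using assms by (auto simp: clog_density_def intro!: divide_strict_left_mono)

lemma clog_density_nonneg: "b \<ge> 2 \<Longrightarrow> x \<ge> 0 \<Longrightarrow> clog_density b x \<ge> 0"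
  by (rule less_imp_le[OF clog_density_pos])

text \<open>The sequence that telescopes in the sum over a, with s standing for c + t; its vanishing
  limit removes the boundary term.\<close>

lemma tendsto_inverse_power_shift:
  assumes "b \<ge> 2" "s > 0"
  shows "(\<lambda>a. 1 / (s * (real b ^ a * s + 1))) \<longlonglongrightarrow> 0"
proof -
  have lim: "(\<lambda>a. inverse (real b ^ a) * (1 / s\<^sup>2)) \<longlonglongrightarrow> 0 * (1 / s\<^sup>2)"
    using assms by (intro tendsto_mult_right LIMSEQ_inverse_realpow_zero) auto
  have le: "1 / (s * (real b ^ a * s + 1)) \<le> inverse (real b ^ a) * (1 / s\<^sup>2)" for a
  proof -
    have "1 / (s * (real b ^ a * s + 1)) \<le> 1 / (s * (real b ^ a * s))"
      using assms by (intro divide_left_mono mult_left_mono mult_pos_pos add_pos_pos) auto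
    then show ?thesis by (simp add: inverse_eq_divide power2_eq_square mult_ac)
  qed
  show ?thesis
  proof (rule tendsto_sandwich[OF _ _ tendsto_const])
    show "\<forall>\<^sub>F a in sequentially. 0 \<le> 1 / (s * (real b ^ a * s + 1))" using assms by simp
    show "\<forall>\<^sub>F a in sequentially. 1 / (s * (real b ^ a * s + 1)) \<le> inverse (real b ^ a) * (1 / s\<^sup>2)"
      using le by simp
    show "(\<lambda>a. inverse (real b ^ a) * (1 / s\<^sup>2)) \<longlonglongrightarrow> 0" using lim by simp
  qed
qed

text \<open>The sum over \<open>a\<close> telescopes to \<open>1 / (c + t) - 1 / (c + 1 + t)\<close>, and then so does the one over \<open>c\<close>.\<close>

lemma transfer_clog_density:
  assumes b: "b \<ge> 2" and t: "t > 0"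
  shows "(\<Sum>c\<in>{1..<b}. \<Sum>a. ennreal (clog_density b (clog_branch b a c t)) * ennreal (clog_jac b a c t))
    = ennreal (clog_density b t)"
proof -
  have "(\<Sum>a. ennreal (clog_density b (clog_branch b a c t)) * ennreal (clog_jac b a c t))
      = ennreal (1 / (c + t) - 1 / (Suc c + t))" if c: "c \<in> {1..<b}" for c
  proof -
    define s where "s = real c + t"
    define u where "u a = 1 / (s * (real b ^ a * s + 1))" for a
    have s: "s > 0" using t by (simp add: s_def)
    \<comment> \<open>The constant b in the second fraction of the density turns b^a into b^(a + 1).
      This is the origin of the density: the second fraction at a cancels the first one at a +
      1.\<close>
    have eq: "clog_density b (clog_branch b a c t) * clog_jac b a c t = u a - u (Suc a)" for a
    proof -
      define q where "q = real b ^ a"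
      have q: "q > 0" using b by (simp add: q_def)
      have "q * s > 0" "real b * q * s > 0" using q s b by auto
      then have "q * s + 1 \<noteq> 0" "real b * q * s + 1 \<noteq> 0" by linarith+
      moreover have "clog_density b (clog_branch b a c t) * clog_jac b a c t = (1 / (1 + 1 / (q * s)) - 1 / (real b + 1 / (q * s))) * (1 / (q * s\<^sup>2))"
        by (simp add: clog_density_def clog_branch_def clog_jac_def q_def s_def)
      moreover have "1 / (1 + 1 / (q * s)) = q * s / (q * s + 1)" "1 / (real b + 1 / (q * s)) = q * s / (real b * q * s + 1)"
        using q s by (simp_all add: divide_simps)
      moreover have "u a - u (Suc a) = 1 / (s * (q * s + 1)) - 1 / (s * (real b * q * s + 1))"
        by (simp add: u_def q_def)
      moreover have "(q * s / D - q * s / E) * (1 / (q * s\<^sup>2)) = 1 / (s * D) - 1 / (s * E)"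
        if "D \<noteq> 0" "E \<noteq> 0" for D E
        using q s that by (simp add: field_simps power2_eq_square)
      ultimately show ?thesis by simp
    qed
    have "(\<lambda>a. u a - u (Suc a)) sums (u 0 - 0)"
      unfolding u_def by (intro telescope_sums' tendsto_inverse_power_shift b s)
    moreover have "u 0 = 1 / (c + t) - 1 / (Suc c + t)"
      using t by (simp add: u_def s_def divide_simps)
    ultimately have sums: "(\<lambda>a. clog_density b (clog_branch b a c t) * clog_jac b a c t) sums (1 / (c + t) - 1 / (Suc c + t))"
      by (simp add: eq)
    have nonneg: "clog_density b (clog_branch b a c t) \<ge> 0" "clog_jac b a c t \<ge> 0" for a
      using clog_branch_bounds[OF b c t] by (auto intro: clog_density_nonneg[OF b] less_imp_le simp: clog_jac_def)
    show ?thesis using suminf_ennreal_eq[OF _ sums] nonneg by (simp add: ennreal_mult)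
  qed
  then have "(\<Sum>c\<in>{1..<b}. \<Sum>a. ennreal (clog_density b (clog_branch b a c t)) * ennreal (clog_jac b a c t))
      = (\<Sum>c\<in>{1..<b}. ennreal (1 / (c + t) - 1 / (Suc c + t)))" by simp
  also have "\<dots> = ennreal (\<Sum>c\<in>{1..<b}. 1 / (c + t) - 1 / (Suc c + t))"
    using t by (intro sum_ennreal) (auto simp: divide_simps)
  also have "(\<Sum>c\<in>{1..<b}. 1 / (c + t) - 1 / (Suc c + t)) = clog_density b t"
    using sum_Suc_diff'[of 1 b "\<lambda>i. - (1 / (real i + t))"] b by (simp add: clog_density_def)
  finally show ?thesis .
qed

lemma emeasure_clog_measure:
  assumes [measurable]: "A \<in> sets borel"
  shows "emeasure (clog_measure b) A = (\<integral>\<^sup>+x. ennreal (clog_density b x) * indicator A x * indicator {0<..<1} x \<partial>lborel)"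
  by (auto simp: clog_measure_def emeasure_density mult_ac intro!: nn_integral_cong)

text \<open>On each cylinder the map undoes the branch, so after the change of variables the
  indicator of A no longer depends on the digits. It factors out of the sums, and what remains is
  \<open>transfer_clog_density\<close>.\<close>

lemma measure_preserving_clog_map:
  assumes b: "b \<ge> 2"
  shows "measure_preserving (clog_measure b) (clog_map b)"
proof
  show [measurable]: "clog_map b \<in> measurable (clog_measure b) (clog_measure b)"
    by measurable
  show "distr (clog_measure b) (clog_measure b) (clog_map b) = clog_measure b"
  proof (rule measure_eqI)
    fix A assume "A \<in> sets (distr (clog_measure b) (clog_measure b) (clog_map b))"
    then have [measurable]: "A \<in> sets borel" by simp
    have "emeasure (distr (clog_measure b) (clog_measure b) (clog_map b)) A =
        (\<integral>\<^sup>+x. ennreal (clog_density b x) * indicator A (clog_map b x) * indicator {0<..<1} x \<partial>lborel)"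
      by (subst emeasure_distr)
        (auto simp: emeasure_clog_measure measurable_sets_borel[OF clog_map_measurable] indicator_def intro!: nn_integral_cong)
    also have "\<dots> = (\<Sum>c\<in>{1..<b}. \<Sum>a. \<integral>\<^sup>+t. ennreal (clog_density b (clog_branch b a c t)) *
        indicator A (clog_map b (clog_branch b a c t)) * ennreal (clog_jac b a c t) * indicator {0<..<1} t \<partial>lborel)"
      by (rule nn_integral_clog_branches[OF b]) measurable
    also have "\<dots> = (\<Sum>c\<in>{1..<b}. \<Sum>a. \<integral>\<^sup>+t. ennreal (clog_density b (clog_branch b a c t)) *
        ennreal (clog_jac b a c t) * (indicator A t * indicator {0<..<1} t) \<partial>lborel)"
    proof (intro sum.cong refl suminf_cong nn_integral_cong)
      fix c a t assume c: "c \<in> {1..<b}"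
      show "ennreal (clog_density b (clog_branch b a c t)) *
          indicator A (clog_map b (clog_branch b a c t)) * ennreal (clog_jac b a c t) * indicator {0<..<1} t =
        ennreal (clog_density b (clog_branch b a c t)) *
          ennreal (clog_jac b a c t) * (indicator A t * indicator {0<..<1} t)"
        using clog_branch_inverse(3)[OF b c, of t a] by (auto simp: indicator_def)
    qed
    also have "\<dots> = (\<integral>\<^sup>+t. (\<Sum>c\<in>{1..<b}. \<Sum>a. ennreal (clog_density b (clog_branch b a c t)) *
        ennreal (clog_jac b a c t)) * (indicator A t * indicator {0<..<1} t) \<partial>lborel)"
      by (subst nn_integral_sum_suminf[symmetric], measurable)
        (simp only: ennreal_suminf_multc sum_distrib_right)
    also have "\<dots> = (\<integral>\<^sup>+t. ennreal (clog_density b t) * (indicator A t * indicator {0<..<1} t) \<partial>lborel)"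
      using transfer_clog_density[OF b] by (intro nn_integral_cong) (simp add: indicator_def del: One_nat_def)
    also have "\<dots> = emeasure (clog_measure b) A"
      by (simp add: emeasure_clog_measure mult_ac)
    finally show "emeasure (distr (clog_measure b) (clog_measure b) (clog_map b)) A = emeasure (clog_measure b) A" .
  qed simp
qed

lemma clog_antiderivative:
  assumes "b \<ge> 2" "x \<ge> 0"
  shows "((\<lambda>x. ln (1 + x) - ln (real b + x)) has_real_derivative clog_density b x) (at x)"
  using assms unfolding clog_density_def by (auto intro!: derivative_eq_intros)

lemma emeasure_clog_measure_UNIV:
  assumes b: "b \<ge> 2"
  shows "emeasure (clog_measure b) UNIV = ennreal (ln (2 * real b / (real b + 1)))"
proof -
  have "emeasure (clog_measure b) UNIV = (\<integral>\<^sup>+x. ennreal (clog_density b x) * indicator {0..1} x \<partial>lborel)"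
    unfolding emeasure_clog_measure[OF sets.top[of borel, unfolded space_borel]]
  proof (rule nn_integral_cong_AE)
    have "AE x::real in lborel. x \<noteq> 0" "AE x::real in lborel. x \<noteq> 1" by (auto intro: AE_lborel_singleton)
    then show "AE x in lborel. ennreal (clog_density b x) * indicator UNIV x * indicator {0<..<1} x
        = ennreal (clog_density b x) * indicator {0..1} x"
      by eventually_elim (auto simp: indicator_def)
  qed
  also have "\<dots> = ennreal ((ln (1 + 1) - ln (real b + 1)) - (ln (1 + 0) - ln (real b + 0)))"
    by (intro nn_integral_FTC_Icc clog_antiderivative[OF b] clog_density_nonneg[OF b]) auto
  also have "(ln (1 + 1) - ln (real b + 1)) - (ln (1 + 0) - ln (real b + 0)) = ln (2 * real b / (real b + 1))"
    using b by (simp add: ln_div ln_mult)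
  finally show ?thesis .
qed

section \<open>Ergodicity\<close>

text \<open>With respect to the distance \<open>\<bar>ln (1 + x) - ln (1 + y)\<bar>\<close> all branches contract uniformly; for the
  Euclidean distance the branch with \<open>a = 0\<close> and \<open>c = 1\<close> is not a contraction at \<open>0\<close>.\<close>

lemma clog_branch_contraction:
  assumes b: "b \<ge> 2" and c: "c \<in> {1..<b}" and t: "0 < t" and u: "0 < u"
  shows "\<bar>ln (1 + clog_branch b a c t) - ln (1 + clog_branch b a c u)\<bar> \<le> \<bar>ln (1 + t) - ln (1 + u)\<bar> / 2"
proof -
  have wlog: "\<bar>ln (1 + clog_branch b a c t) - ln (1 + clog_branch b a c u)\<bar> \<le> \<bar>ln (1 + t) - ln (1 + u)\<bar> / 2"
    if t: "0 < t" and tu: "t \<le> u" for t u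
  proof -
    define q where "q = real b ^ a"
    have q: "q \<ge> 1" using b by (simp add: q_def)
    have c1: "real c \<ge> 1" using c by simp
    \<comment> \<open>The branch is decreasing, so contraction by 1/2 amounts to monotonicity of
      this function. The constant comes from q v \<ge> 1 and v \<ge> 1 + s, which give v (q v + 1)
      \<ge> 2 (1 + s).\<close>
    define f where "f s = ln (1 + 1 / (q * (real c + s))) + 1 / 2 * ln (1 + s)" for s
    have "f t \<le> f u"
    proof (rule DERIV_nonneg_imp_nondecreasing[OF tu])
      fix s assume "t \<le> s" "s \<le> u"
      then have s: "s > 0" using t by simp
      define v where "v = real c + s"
      have v: "v \<ge> 1 + s" using c1 by (simp add: v_def)
      have qv: "q * v \<ge> 1" using q v s mult_mono[of 1 q 1 v] by simp
      have "(f has_real_derivative (- (1 / (q * v\<^sup>2)) / (1 + 1 / (q * v)) + 1 / 2 * (1 / (1 + s)))) (at s)"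
        unfolding f_def v_def using q s c1
        by (auto intro!: derivative_eq_intros add_pos_pos simp: power2_eq_square mult_ac) (simp add: field_simps)
      moreover have "1 / (q * v\<^sup>2) / (1 + 1 / (q * v)) = 1 / (v * (q * v + 1))"
        using qv v s q by (simp add: field_simps power2_eq_square)
      moreover have "1 / (v * (q * v + 1)) \<le> 1 / ((1 + s) * 2)"
        using qv v s by (intro divide_left_mono mult_mono mult_pos_pos) auto
      ultimately show "\<exists>y. (f has_real_derivative y) (at s) \<and> 0 \<le> y"
        by (intro exI[of _ "- (1 / (q * v\<^sup>2)) / (1 + 1 / (q * v)) + 1 / 2 * (1 / (1 + s))"]) (auto simp: mult.commute)
    qed
    moreover have "1 / (q * (real c + u)) \<le> 1 / (q * (real c + t))"
      using q c1 t tu by (intro divide_left_mono mult_left_mono mult_pos_pos) auto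
    moreover have "1 / (q * (real c + u)) \<ge> 0" using q c1 t tu by simp
    ultimately have "ln (1 + 1 / (q * (real c + u))) \<le> ln (1 + 1 / (q * (real c + t)))"
      by (intro ln_mono) linarith+
    moreover have "ln (1 + t) \<le> ln (1 + u)" using t tu by simp
    moreover note \<open>f t \<le> f u\<close>
    moreover have "\<bar>x - x'\<bar> \<le> \<bar>l - l'\<bar> / 2" if "x' \<le> x" "l \<le> l'" "x + 1 / 2 * l \<le> x' + 1 / 2 * l'"
      for x x' l l' :: real
      using that by simp
    ultimately show ?thesis unfolding f_def clog_branch_def q_def[symmetric] by blast
  qed
  show ?thesis using wlog[of t u] wlog[of u t] t u by (cases "t \<le> u") (auto simp: abs_minus_commute)
qed

text \<open>Up to a constant factor, \<open>clog_weight w\<close> is the density of \<open>T\<^sup>n x\<close> for \<open>x\<close> uniformly distributed in a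
  cylinder of rank \<open>n\<close>, where \<open>w \<in> {0..1}\<close> depends on the cylinder.\<close>

definition clog_weight :: "real \<Rightarrow> real \<Rightarrow> real" where
  "clog_weight w t = 1 / (1 + w * t)\<^sup>2"

lemma clog_weight_measurable [measurable]: "clog_weight w \<in> borel_measurable borel"
  unfolding clog_weight_def by measurable

lemma clog_weight_nonneg [simp]: "clog_weight w t \<ge> 0"
  by (simp add: clog_weight_def)

lemma clog_weight_0 [simp]: "clog_weight 0 t = 1"
  by (simp add: clog_weight_def)

lemma clog_weight_le_1: "0 \<le> w \<Longrightarrow> 0 \<le> t \<Longrightarrow> clog_weight w t \<le> 1"
  by (simp add: clog_weight_def divide_simps)

lemma clog_weight_ge:
  assumes "0 \<le> w" "w \<le> 1" "0 \<le> t" "t \<le> 1"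
  shows "clog_weight w t \<ge> 1 / 4"
proof -
  have "w * t \<le> 1 * 1" using assms by (intro mult_mono) auto
  then have "(1 + w * t)\<^sup>2 \<le> 2\<^sup>2" using assms by (intro power_mono) auto
  moreover have "1 + w * t > 0" using assms by (simp add: add_pos_nonneg)
  ultimately have "1 / 2\<^sup>2 \<le> 1 / (1 + w * t)\<^sup>2"
    by (intro divide_left_mono) auto
  then show ?thesis by (simp add: clog_weight_def)
qed

text \<open>The branches are Moebius maps: multiplying 1 + w / (q v), where v = c + t and q = b^a,
  by v yields z + t with z = c + w / q, again affine in t. Hence the family of weights is stable
  under the branches, and c \<ge> 1 keeps the new parameter 1 / z in [0,1].\<close>

lemma clog_weight_branch:
  fixes a c :: nat
  assumes b: "b \<ge> 2" and c: "c \<in> {1..<b}" and t: "0 \<le> t" and w: "0 \<le> w"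
  defines "w' \<equiv> 1 / (real c + w / real b ^ a)"
  shows "clog_weight w (clog_branch b a c t) * clog_jac b a c t = w'\<^sup>2 / real b ^ a * clog_weight w' t"
proof -
  define q where "q = real b ^ a"
  have q: "q > 0" using b by (simp add: q_def)
  define v where "v = real c + t"
  have c1: "real c \<ge> 1" using c by simp
  have v: "v > 0" using c1 t by (simp add: v_def)
  define z where "z = real c + w / q"
  have z: "z > 0" using c1 q w by (simp add: z_def add_pos_nonneg)
  have nz: "q * v + w > 0" "z + t > 0" using q v w z t by (auto intro!: add_pos_nonneg)
  have "clog_weight w (clog_branch b a c t) * clog_jac b a c t = 1 / (1 + w / (q * v))\<^sup>2 * (1 / (q * v\<^sup>2))"
    by (simp add: clog_weight_def clog_branch_def clog_jac_def q_def v_def)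
  also have "1 + w / (q * v) = (z + t) / v"
  proof -
    have "z + t = v + w / q" by (simp add: z_def v_def)
    then show ?thesis using v by (simp add: add_divide_distrib)
  qed
  also have "1 / ((z + t) / v)\<^sup>2 * (1 / (q * v\<^sup>2)) = 1 / (q * (z + t)\<^sup>2)"
    using q v nz by (simp add: power_divide field_simps)
  also have "\<dots> = (1 / z)\<^sup>2 / q * (1 / (1 + 1 / z * t)\<^sup>2)"
  proof -
    have "1 + 1 / z * t = (z + t) / z" using z by (simp add: field_simps)
    then show ?thesis using z q nz by (simp add: power_divide)
  qed
  finally show ?thesis by (simp add: w'_def clog_weight_def z_def q_def)
qed

lemma nn_integral_clog_weight_branches:
  fixes g :: "real \<Rightarrow> ennreal"
  assumes b: "b \<ge> 2" and w: "0 \<le> w" and [measurable]: "g \<in> borel_measurable borel"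
  shows "(\<integral>\<^sup>+x. g x * ennreal (clog_weight w x) * indicator {0<..<1} x \<partial>lborel) =
    (\<Sum>c\<in>{1..<b}. \<Sum>a. ennreal ((1 / (real c + w / real b ^ a))\<^sup>2 / real b ^ a) *
      (\<integral>\<^sup>+t. g (clog_branch b a c t) * ennreal (clog_weight (1 / (real c + w / real b ^ a)) t) * indicator {0<..<1} t \<partial>lborel))"
proof -
  have "(\<integral>\<^sup>+x. g x * ennreal (clog_weight w x) * indicator {0<..<1} x \<partial>lborel) =
    (\<Sum>c\<in>{1..<b}. \<Sum>a. \<integral>\<^sup>+t. g (clog_branch b a c t) * ennreal (clog_weight w (clog_branch b a c t)) *
      ennreal (clog_jac b a c t) * indicator {0<..<1} t \<partial>lborel)"
    by (rule nn_integral_clog_branches[OF b]) measurable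
  also have "\<dots> = (\<Sum>c\<in>{1..<b}. \<Sum>a. \<integral>\<^sup>+t. ennreal ((1 / (real c + w / real b ^ a))\<^sup>2 / real b ^ a) * (g (clog_branch b a c t) *
      ennreal (clog_weight (1 / (real c + w / real b ^ a)) t) * indicator {0<..<1} t) \<partial>lborel)"
  proof (intro sum.cong refl suminf_cong nn_integral_cong)
    fix c a t assume c: "c \<in> {1..<b}"
    have "ennreal (clog_weight w (clog_branch b a c t)) * ennreal (clog_jac b a c t) =
      ennreal ((1 / (real c + w / real b ^ a))\<^sup>2 / real b ^ a) * ennreal (clog_weight (1 / (real c + w / real b ^ a)) t)"
      if "0 \<le> t"
      using clog_weight_branch[OF b c that w, of a] w
      by (simp add: ennreal_mult[symmetric] clog_jac_def)
    then have "g (clog_branch b a c t) * (ennreal (clog_weight w (clog_branch b a c t)) * ennreal (clog_jac b a c t)) * indicator {0<..<1} t =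
        g (clog_branch b a c t) * (ennreal ((1 / (real c + w / real b ^ a))\<^sup>2 / real b ^ a) *
          ennreal (clog_weight (1 / (real c + w / real b ^ a)) t)) * indicator {0<..<1} t"
      by (cases "0 < t \<and> t < 1") auto
    then show "g (clog_branch b a c t) * ennreal (clog_weight w (clog_branch b a c t)) *
        ennreal (clog_jac b a c t) * indicator {0<..<1} t =
      ennreal ((1 / (real c + w / real b ^ a))\<^sup>2 / real b ^ a) * (g (clog_branch b a c t) *
        ennreal (clog_weight (1 / (real c + w / real b ^ a)) t) * indicator {0<..<1} t)"
      by (simp only: mult_ac)
  qed
  also have "\<dots> = (\<Sum>c\<in>{1..<b}. \<Sum>a. ennreal ((1 / (real c + w / real b ^ a))\<^sup>2 / real b ^ a) *
      (\<integral>\<^sup>+t. g (clog_branch b a c t) * ennreal (clog_weight (1 / (real c + w / real b ^ a)) t) * indicator {0<..<1} t \<partial>lborel))"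
    by (simp add: nn_integral_cmult)
  finally show ?thesis .
qed

text \<open>In the induction step the integral is split along the branches. Composition with a
  branch halves K, the weight parameter stays in [0,1], and invariance lets the indicator of A be
  read at t or at its image under the branch alike. So the inequality for n and K / 2 on every
  branch sums up to the one for n + 1 and K.\<close>

lemma clog_invariant_weighted_bound:
  assumes b: "b \<ge> 2" and A [measurable]: "A \<in> sets borel" and inv: "\<And>x. clog_map b x \<in> A \<longleftrightarrow> x \<in> A"
  defines "k \<equiv> measure lborel (A \<inter> {0<..<1}) / 4"
  assumes w: "0 \<le> w" "w \<le> 1" and g [measurable]: "g \<in> borel_measurable borel" and nonneg: "\<And>x. g x \<ge> 0"
    and K: "K \<ge> 0"
    and lip: "\<And>x y. x \<in> {0<..<1} \<Longrightarrow> y \<in> {0<..<1} \<Longrightarrow> g x \<le> g y + K * \<bar>ln (1 + x) - ln (1 + y)\<bar>"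
  shows "(\<integral>\<^sup>+x. ennreal (k * g x) * ennreal (clog_weight w x) * indicator {0<..<1} x \<partial>lborel) \<le>
    (\<integral>\<^sup>+x. (indicator A x * ennreal (g x) + ennreal (k * K / 2 ^ n)) * ennreal (clog_weight w x) * indicator {0<..<1} x \<partial>lborel)"
  using w g nonneg K lip
proof (induction n arbitrary: w g K)
  case 0
  note [measurable] = 0(3)
  have k: "k \<ge> 0" by (simp add: k_def)
  \<comment> \<open>The logarithmic distance on (0,1) is at most ln 2 \<le> 1, so g stays between
    its infimum m and m + K. The excess K is paid for by the error term, and only the constant m has
    to be compared with the integral over A.\<close>
  define m where "m = Inf (g ` {0<..<1})"
  have bdd: "bdd_below (g ` {0<..<1})" using 0 by (intro bdd_belowI2[of _ 0]) auto
  have m0: "m \<ge> 0" unfolding m_def using 0 by (intro cINF_greatest) auto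
  have m_le: "m \<le> g x" if "x \<in> {0<..<1}" for x unfolding m_def using that bdd by (intro cINF_lower) auto
  have g_le: "g x \<le> m + K" if x: "x \<in> {0<..<1}" for x
  proof -
    have "g x - K \<le> g y" if y: "y \<in> {0<..<1}" for y
    proof -
      have "ln (1 + x) \<le> ln 2" "ln (1 + y) \<le> ln 2" "0 \<le> ln (1 + x)" "0 \<le> ln (1 + y)" using x y by auto
      moreover have "ln (2::real) \<le> 1" using ln_le_minus_one[of 2] by simp
      ultimately have "\<bar>ln (1 + x) - ln (1 + y)\<bar> \<le> 1" by linarith
      then have "K * \<bar>ln (1 + x) - ln (1 + y)\<bar> \<le> K * 1" using 0 by (intro mult_left_mono) auto
      then show ?thesis using 0(6)[OF x y] by linarith
    qed
    then have "g x - K \<le> m" unfolding m_def by (intro cINF_greatest) auto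
    then show ?thesis by simp
  qed
  have "(\<integral>\<^sup>+x. ennreal (k * g x) * ennreal (clog_weight w x) * indicator {0<..<1} x \<partial>lborel) \<le>
    (\<integral>\<^sup>+x. ennreal (k * m) * indicator {0<..<1} x + ennreal (k * K) * ennreal (clog_weight w x) * indicator {0<..<1} x \<partial>lborel)"
  proof (rule nn_integral_mono)
    fix x :: real
    show "ennreal (k * g x) * ennreal (clog_weight w x) * indicator {0<..<1} x \<le>
      ennreal (k * m) * indicator {0<..<1} x + ennreal (k * K) * ennreal (clog_weight w x) * indicator {0<..<1} x"
    proof (cases "x \<in> {0<..<1}")
      case True
      have "k * g x * clog_weight w x \<le> k * (m + K) * clog_weight w x"
        using g_le[OF True] k by (intro mult_right_mono mult_left_mono) auto
      also have "\<dots> = k * m * clog_weight w x + k * K * clog_weight w x" by (simp add: algebra_simps)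
      also have "k * m * clog_weight w x \<le> k * m * 1"
        using k m0 0 True clog_weight_le_1[of w x] by (intro mult_left_mono) auto
      finally have "k * g x * clog_weight w x \<le> k * m + k * K * clog_weight w x" by simp
      then have "ennreal (k * g x * clog_weight w x) \<le> ennreal (k * m + k * K * clog_weight w x)"
        by (rule ennreal_leI)
      then show ?thesis using True k m0 0 by (simp add: ennreal_mult ennreal_plus)
    qed simp
  qed
  also have "\<dots> = ennreal (k * m) + (\<integral>\<^sup>+x. ennreal (k * K) * ennreal (clog_weight w x) * indicator {0<..<1} x \<partial>lborel)"
    by (subst nn_integral_add) (auto simp: nn_integral_cmult_indicator)
  \<comment> \<open>The divisor 4 in \<open>k\<close> is the lower bound 1/4 of the weights: m / 4
    is below g times the weight on A.\<close>
  also have "ennreal (k * m) = (\<integral>\<^sup>+x. ennreal (m / 4) * indicator (A \<inter> {0<..<1}) x \<partial>lborel)"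
  proof -
    have "emeasure lborel (A \<inter> {0<..<1}) \<le> emeasure lborel {0<..<1::real}" by (intro emeasure_mono) auto
    then have "emeasure lborel (A \<inter> {0<..<1}) = ennreal (measure lborel (A \<inter> {0<..<1}))"
      by (intro emeasure_eq_ennreal_measure) (auto simp: top_unique)
    then show ?thesis using m0 by (subst nn_integral_cmult_indicator) (auto simp: k_def ennreal_mult[symmetric])
  qed
  also have "\<dots> \<le> (\<integral>\<^sup>+x. indicator A x * ennreal (g x) * ennreal (clog_weight w x) * indicator {0<..<1} x \<partial>lborel)"
  proof (rule nn_integral_mono)
    fix x :: real
    show "ennreal (m / 4) * indicator (A \<inter> {0<..<1}) x \<le> indicator A x * ennreal (g x) * ennreal (clog_weight w x) * indicator {0<..<1} x"
    proof (cases "x \<in> A \<inter> {0<..<1}")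
      case True
      have "m * (1 / 4) \<le> g x * clog_weight w x"
        using True m_le[of x] m0 clog_weight_ge[of w x] 0 by (intro mult_mono) auto
      then have "ennreal (m / 4) \<le> ennreal (g x * clog_weight w x)" by (intro ennreal_leI) simp
      then show ?thesis using True 0 by (simp add: ennreal_mult)
    qed simp
  qed
  also have "\<dots> + (\<integral>\<^sup>+x. ennreal (k * K) * ennreal (clog_weight w x) * indicator {0<..<1} x \<partial>lborel) =
    (\<integral>\<^sup>+x. (indicator A x * ennreal (g x) + ennreal (k * K / 2 ^ 0)) * ennreal (clog_weight w x) * indicator {0<..<1} x \<partial>lborel)"
    by (subst nn_integral_add[symmetric]) (auto simp: algebra_simps)
  finally show ?case by simp
next
  case (Suc n)
  note [measurable] = Suc.prems(3)
  let ?w = "\<lambda>c a. 1 / (real c + w / real b ^ a)"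
  have "(\<integral>\<^sup>+x. ennreal (k * g x) * ennreal (clog_weight w x) * indicator {0<..<1} x \<partial>lborel) =
    (\<Sum>c\<in>{1..<b}. \<Sum>a. ennreal ((?w c a)\<^sup>2 / real b ^ a) *
      (\<integral>\<^sup>+t. ennreal (k * g (clog_branch b a c t)) * ennreal (clog_weight (?w c a) t) * indicator {0<..<1} t \<partial>lborel))"
    by (rule nn_integral_clog_weight_branches[OF b]) (use Suc.prems in auto)
  also have "\<dots> \<le> (\<Sum>c\<in>{1..<b}. \<Sum>a. ennreal ((?w c a)\<^sup>2 / real b ^ a) *
      (\<integral>\<^sup>+t. (indicator A (clog_branch b a c t) * ennreal (g (clog_branch b a c t)) + ennreal (k * K / 2 ^ Suc n)) *
        ennreal (clog_weight (?w c a) t) * indicator {0<..<1} t \<partial>lborel))"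
  proof (intro sum_mono suminf_le mult_left_mono)
    fix c a assume c: "c \<in> {1..<b}"
    have c1: "real c \<ge> 1" using c by simp
    have "real c + w / real b ^ a \<ge> 1" using c1 Suc.prems by (intro add_increasing2) auto
    then have w': "0 \<le> ?w c a" "?w c a \<le> 1" by (auto simp: divide_simps)
    have "(\<integral>\<^sup>+t. ennreal (k * g (clog_branch b a c t)) * ennreal (clog_weight (?w c a) t) * indicator {0<..<1} t \<partial>lborel) \<le>
      (\<integral>\<^sup>+t. (indicator A t * ennreal (g (clog_branch b a c t)) + ennreal (k * (K / 2) / 2 ^ n)) *
        ennreal (clog_weight (?w c a) t) * indicator {0<..<1} t \<partial>lborel)"
    proof (rule Suc.IH[OF w'])
      fix x y :: real assume x: "x \<in> {0<..<1}" and y: "y \<in> {0<..<1}"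
      have "g (clog_branch b a c x) \<le> g (clog_branch b a c y) +
          K * \<bar>ln (1 + clog_branch b a c x) - ln (1 + clog_branch b a c y)\<bar>"
        using x y clog_branch_bounds[OF b c] by (intro Suc.prems) auto
      also have "\<dots> \<le> g (clog_branch b a c y) + K * (\<bar>ln (1 + x) - ln (1 + y)\<bar> / 2)"
        using clog_branch_contraction[OF b c] x y Suc.prems by (intro add_left_mono mult_left_mono) auto
      finally show "g (clog_branch b a c x) \<le> g (clog_branch b a c y) + K / 2 * \<bar>ln (1 + x) - ln (1 + y)\<bar>" by simp
    qed (use Suc.prems in auto)
    also have "\<dots> = (\<integral>\<^sup>+t. (indicator A (clog_branch b a c t) * ennreal (g (clog_branch b a c t)) + ennreal (k * K / 2 ^ Suc n)) *
        ennreal (clog_weight (?w c a) t) * indicator {0<..<1} t \<partial>lborel)"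
    proof (intro nn_integral_cong)
      fix t :: real
      have "indicator A (clog_branch b a c t) = (indicator A t :: ennreal)" if "0 < t" "t < 1"
        using inv[of "clog_branch b a c t"] clog_branch_inverse(3)[OF b c, of t a] that by (simp add: indicator_def)
      then show "(indicator A t * ennreal (g (clog_branch b a c t)) + ennreal (k * (K / 2) / 2 ^ n)) *
        ennreal (clog_weight (?w c a) t) * indicator {0<..<1} t =
        (indicator A (clog_branch b a c t) * ennreal (g (clog_branch b a c t)) + ennreal (k * K / 2 ^ Suc n)) *
        ennreal (clog_weight (?w c a) t) * indicator {0<..<1} t"
        by (cases "0 < t \<and> t < 1") auto
    qed
    finally show "(\<integral>\<^sup>+t. ennreal (k * g (clog_branch b a c t)) * ennreal (clog_weight (?w c a) t) * indicator {0<..<1} t \<partial>lborel) \<le> \<dots>" .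
  qed auto
  also have "\<dots> = (\<integral>\<^sup>+x. (indicator A x * ennreal (g x) + ennreal (k * K / 2 ^ Suc n)) * ennreal (clog_weight w x) * indicator {0<..<1} x \<partial>lborel)"
    by (rule nn_integral_clog_weight_branches[OF b, symmetric]) (use Suc.prems in auto)
  finally show ?case .
qed

text \<open>This is the weight with w = 0 in the limit of large n. On (0,1) the derivative of ln (1
  + x) is at least 1/2, so a Euclidean Lipschitz constant L becomes 2 L for the logarithmic
  distance.\<close>

lemma clog_invariant_bound:
  assumes b: "b \<ge> 2" and A [measurable]: "A \<in> sets borel" and inv: "\<And>x. clog_map b x \<in> A \<longleftrightarrow> x \<in> A"
  defines "k \<equiv> measure lborel (A \<inter> {0<..<1}) / 4"
  assumes g [measurable]: "g \<in> borel_measurable borel" and nonneg: "\<And>x. g x \<ge> 0"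
    and lip: "\<And>x y. \<bar>g x - g y\<bar> \<le> L * \<bar>x - y\<bar>"
  shows "(\<integral>\<^sup>+x. ennreal (k * g x) * indicator {0<..<1} x \<partial>lborel) \<le>
    (\<integral>\<^sup>+x. indicator A x * ennreal (g x) * indicator {0<..<1} x \<partial>lborel)"
proof (rule ennreal_le_epsilon)
  fix e :: real assume e: "e > 0"
  have L: "L \<ge> 0" using lip[of 1 0] by simp
  have k: "k \<ge> 0" by (simp add: k_def)
  have lip': "g x \<le> g y + 2 * L * \<bar>ln (1 + x) - ln (1 + y)\<bar>" if xy: "x \<in> {0<..<1}" "y \<in> {0<..<1}" for x y
  proof -
    have *: "y - x \<le> 2 * (ln (1 + y) - ln (1 + x))" if "x \<in> {0<..<1}" "y \<in> {0<..<1}" "x \<le> y" for x y :: real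
    proof -
      have "(y - x) / 2 \<le> (y - x) / (1 + y)" using that by (intro divide_left_mono) auto
      also have "\<dots> = 1 - (1 + x) / (1 + y)" using that by (simp add: field_simps)
      also have "\<dots> \<le> - ln ((1 + x) / (1 + y))" using that ln_le_minus_one[of "(1 + x) / (1 + y)"] by simp
      also have "\<dots> = ln (1 + y) - ln (1 + x)" using that by (simp add: ln_div)
      finally show ?thesis by simp
    qed
    have "\<bar>x - y\<bar> \<le> 2 * \<bar>ln (1 + x) - ln (1 + y)\<bar>"
      using *[of x y] *[of y x] xy by (cases "x \<le> y") auto
    then have "L * \<bar>x - y\<bar> \<le> L * (2 * \<bar>ln (1 + x) - ln (1 + y)\<bar>)" using L by (rule mult_left_mono)
    then show ?thesis using lip[of x y] by (simp add: abs_if mult_ac split: if_splits)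
  qed
  obtain n :: nat where n: "k * (2 * L) / e < 2 ^ n" using real_arch_pow[of 2 "k * (2 * L) / e"] by auto
  then have small: "k * (2 * L) / 2 ^ n \<le> e" using e by (simp add: field_simps)
  have "(\<integral>\<^sup>+x. ennreal (k * g x) * indicator {0<..<1} x \<partial>lborel) \<le>
    (\<integral>\<^sup>+x. (indicator A x * ennreal (g x) + ennreal (k * (2 * L) / 2 ^ n)) * indicator {0<..<1} x \<partial>lborel)"
    using clog_invariant_weighted_bound[OF b A inv, of 0 g "2 * L" n] nonneg lip' L by (simp add: k_def)
  also have "\<dots> = (\<integral>\<^sup>+x. indicator A x * ennreal (g x) * indicator {0<..<1} x + ennreal (k * (2 * L) / 2 ^ n) * indicator {0<..<1} x \<partial>lborel)"
    by (simp add: algebra_simps)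
  also have "\<dots> = (\<integral>\<^sup>+x. indicator A x * ennreal (g x) * indicator {0<..<1} x \<partial>lborel) + ennreal (k * (2 * L) / 2 ^ n)"
    by (subst nn_integral_add) (auto simp: nn_integral_cmult_indicator)
  also have "\<dots> \<le> (\<integral>\<^sup>+x. indicator A x * ennreal (g x) * indicator {0<..<1} x \<partial>lborel) + ennreal e"
    using small by (intro add_left_mono ennreal_leI)
  finally show "(\<integral>\<^sup>+x. ennreal (k * g x) * indicator {0<..<1} x \<partial>lborel) \<le>
    (\<integral>\<^sup>+x. indicator A x * ennreal (g x) * indicator {0<..<1} x \<partial>lborel) + ennreal e" .
qed

text \<open>The indicator of U is the increasing limit of the Lipschitz functions min 1 (j d), where
  d is the distance to the complement, so monotone convergence carries the bound over.\<close>

lemma clog_invariant_bound_open: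
  assumes b: "b \<ge> 2" and A [measurable]: "A \<in> sets borel" and inv: "\<And>x. clog_map b x \<in> A \<longleftrightarrow> x \<in> A"
    and U: "open U" "U \<subseteq> {0<..<1}"
  shows "ennreal (measure lborel (A \<inter> {0<..<1}) / 4) * emeasure lborel U \<le> emeasure lborel (A \<inter> U)"
proof -
  define k where "k = measure lborel (A \<inter> {0<..<1}) / 4"
  have k: "k \<ge> 0" by (simp add: k_def)
  have [measurable]: "U \<in> sets borel" using U by simp
  \<comment> \<open>\<open>infdist\<close> to the empty set is 0 by convention, which would make
    every \<open>g j\<close> vanish; here U lies in (0,1), so its complement is not empty.\<close>
  have ne: "- U \<noteq> {}" "closed (- U)" using U by auto
  define g where "g j x = min 1 (real j * infdist x (- U))" for j x
  have [measurable]: "g j \<in> borel_measurable borel" for j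
    unfolding g_def by (intro borel_measurable_continuous_onI continuous_intros)
  have g01: "0 \<le> g j x" "g j x \<le> 1" for j x by (auto simp: g_def infdist_nonneg)
  have lip: "\<bar>g j x - g j y\<bar> \<le> real j * \<bar>x - y\<bar>" for j x y
  proof -
    have "\<bar>g j x - g j y\<bar> \<le> \<bar>real j * infdist x (- U) - real j * infdist y (- U)\<bar>"
      unfolding g_def by linarith
    also have "\<dots> = real j * \<bar>infdist x (- U) - infdist y (- U)\<bar>"
      by (simp add: abs_mult right_diff_distrib[symmetric])
    also have "\<dots> \<le> real j * \<bar>x - y\<bar>"
      using infdist_triangle_abs[of x "- U" y] by (intro mult_left_mono) (auto simp: dist_real_def)
    finally show ?thesis .
  qed
  have g_out: "g j x = 0" if "x \<notin> U" for j x using that by (simp add: g_def)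
  have "ennreal k * emeasure lborel U = (\<integral>\<^sup>+x. ennreal k * indicator U x \<partial>lborel)"
    by (simp add: nn_integral_cmult_indicator)
  also have "\<dots> \<le> (\<integral>\<^sup>+x. (SUP j. ennreal (k * g j x) * indicator {0<..<1} x) \<partial>lborel)"
  proof (rule nn_integral_mono)
    fix x :: real
    show "ennreal k * indicator U x \<le> (SUP j. ennreal (k * g j x) * indicator {0<..<1} x)"
    proof (cases "x \<in> U")
      case True
      then have "infdist x (- U) > 0" using ne infdist_pos_not_in_closed[of "- U" x] by auto
      then obtain j :: nat where "real j * infdist x (- U) > 1"
        using reals_Archimedean3[of "infdist x (- U)"] by blast
      then have "g j x = 1" by (simp add: g_def)
      then show ?thesis using True U by (intro SUP_upper2[of j]) auto
    qed simp
  qed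
  also have "\<dots> = (SUP j. \<integral>\<^sup>+x. ennreal (k * g j x) * indicator {0<..<1} x \<partial>lborel)"
  proof (rule nn_integral_monotone_convergence_SUP)
    show "incseq (\<lambda>j x. ennreal (k * g j x) * indicator {0<..<1} x)"
    proof (intro incseq_SucI le_funI)
      fix j x
      have "real j * infdist x (- U) \<le> real (Suc j) * infdist x (- U)"
        by (intro mult_right_mono) (auto simp: infdist_nonneg)
      then have "g j x \<le> g (Suc j) x" unfolding g_def by linarith
      then show "ennreal (k * g j x) * indicator {0<..<1} x \<le> ennreal (k * g (Suc j) x) * indicator {0<..<1} x"
        using k by (intro mult_right_mono ennreal_leI mult_left_mono) auto
    qed
  qed measurable
  also have "\<dots> \<le> emeasure lborel (A \<inter> U)"
  proof (rule SUP_least)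
    fix j
    have "(\<integral>\<^sup>+x. ennreal (k * g j x) * indicator {0<..<1} x \<partial>lborel) \<le>
      (\<integral>\<^sup>+x. indicator A x * ennreal (g j x) * indicator {0<..<1} x \<partial>lborel)"
      unfolding k_def by (rule clog_invariant_bound[OF b A inv _ g01(1) lip]) measurable
    also have "\<dots> \<le> (\<integral>\<^sup>+x. indicator (A \<inter> U) x \<partial>lborel)"
      using g_out g01 by (intro nn_integral_mono) (auto simp: indicator_def)
    also have "\<dots> = emeasure lborel (A \<inter> U)" by simp
    finally show "(\<integral>\<^sup>+x. ennreal (k * g j x) * indicator {0<..<1} x \<partial>lborel) \<le> emeasure lborel (A \<inter> U)" .
  qed
  finally show ?thesis unfolding k_def .
qed

lemma clog_measure_null:
  assumes [measurable]: "A \<in> sets borel" and "emeasure lborel (A \<inter> {0<..<1}) = 0"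
  shows "emeasure (clog_measure b) A = 0"
proof -
  have "AE x in lborel. x \<notin> A \<inter> {0<..<1}" using assms by (intro AE_not_in) (auto simp: null_sets_def)
  then have "(\<integral>\<^sup>+x. ennreal (clog_density b x) * indicator A x * indicator {0<..<1} x \<partial>lborel) = 0"
    by (subst nn_integral_0_iff_AE) (auto simp: indicator_def elim!: eventually_mono)
  then show ?thesis by (simp add: emeasure_clog_measure)
qed

text \<open>Let B be the part of (0,1) outside A, covered by an open V that exceeds B by measure
  less than e. As A meets V only in the excess, the bound for open sets gives k |B| \<le> k |V|
  \<le> |A \<inter> V| \<le> e for every e, so k = 0 or B is null.\<close>

lemma ergodic_clog_map:
  assumes b: "b \<ge> 2"
  shows "ergodic_system (clog_measure b) (clog_map b)"
proof -
  interpret measure_preserving "clog_measure b" "clog_map b" by (rule measure_preserving_clog_map[OF b])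
  show ?thesis
  proof
    fix A assume "A \<in> sets (clog_measure b)" and invA: "clog_map b -` A \<inter> space (clog_measure b) = A"
    then have A [measurable]: "A \<in> sets borel" by simp
    have inv: "clog_map b x \<in> A \<longleftrightarrow> x \<in> A" for x using invA by auto
    define k where "k = measure lborel (A \<inter> {0<..<1}) / 4"
    define B where "B = - A \<inter> {0<..<1}"
    have [measurable]: "B \<in> sets borel" unfolding B_def by measurable
    have "ennreal k * emeasure lborel B \<le> 0"
    proof (rule ennreal_le_epsilon)
      fix e :: real assume e: "e > 0"
      have "B \<in> sets lebesgue" by simp
      then obtain U where U: "open U" "B \<subseteq> U" "emeasure lebesgue (U - B) < ennreal e"
        using sets_lebesgue_outer_open[OF _ e] by blast
      define V where "V = U \<inter> {0<..<1}"
      have V: "open V" "V \<subseteq> {0<..<1}" "B \<subseteq> V" using U by (auto simp: V_def B_def)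
      have [measurable]: "U \<in> sets borel" "V \<in> sets borel" using U V by auto
      have "ennreal k * emeasure lborel B \<le> ennreal k * emeasure lborel V"
        using V by (intro mult_left_mono emeasure_mono) auto
      also have "\<dots> \<le> emeasure lborel (A \<inter> V)"
        unfolding k_def by (rule clog_invariant_bound_open[OF b A inv V(1,2)])
      also have "\<dots> \<le> emeasure lborel (U - B)" by (intro emeasure_mono) (auto simp: V_def B_def)
      also have "\<dots> \<le> ennreal e" using U(3) by simp
      finally show "ennreal k * emeasure lborel B \<le> 0 + ennreal e" by simp
    qed
    moreover have "k \<ge> 0" by (simp add: k_def)
    ultimately consider "k = 0" | "emeasure lborel B = 0" by (auto simp: ennreal_eq_0_iff)
    then show "emeasure (clog_measure b) A = 0 \<or> emeasure (clog_measure b) (space (clog_measure b) - A) = 0"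
    proof cases
      case 1
      have "emeasure lborel (A \<inter> {0<..<1}) \<le> emeasure lborel {0<..<1::real}" by (intro emeasure_mono) auto
      then have "emeasure lborel (A \<inter> {0<..<1}) = ennreal (4 * k)"
        unfolding k_def by (subst emeasure_eq_ennreal_measure) (auto simp: top_unique)
      then show ?thesis using 1 clog_measure_null[of A b] by simp
    next
      case 2
      then have "emeasure (clog_measure b) (- A) = 0"
        by (intro clog_measure_null) (auto simp: B_def)
      then show ?thesis by (simp add: Compl_eq_Diff_UNIV)
    qed
  qed
qed

section \<open>The mean of the logarithm of a term\<close>

definition clog_log_term :: "nat \<Rightarrow> real \<Rightarrow> real" where
  "clog_log_term b x = ln (of_int (clog_coeff b (1 / x))) + of_int (clog_exp b (1 / x)) * ln (real b)"

lemma clog_log_term_measurable [measurable]: "clog_log_term b \<in> borel_measurable borel"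
  unfolding clog_log_term_def by measurable

lemma clog_log_term_branch:
  assumes "b \<ge> 2" "c \<in> {1..<b}" "0 \<le> t" "t < 1"
  shows "clog_log_term b (clog_branch b a c t) = ln (real c) + real a * ln (real b)"
  using clog_branch_inverse[OF assms] by (simp add: clog_log_term_def)

lemma clog_digits_tail:
  assumes b: "b \<ge> 2" and x: "0 < x" "x < 1"
  shows "clog_exp b (1 / x) \<ge> 0" "clog_coeff b (1 / x) \<ge> 1"
proof -
  have "1 / x \<ge> 1" using x by simp
  then obtain a c where "c \<in> {1..<b}" "real c * real b ^ a \<le> 1 / x" "1 / x < (real c + 1) * real b ^ a"
    using clog_digits_exist[OF b] by metis
  then show "clog_exp b (1 / x) \<ge> 0" "clog_coeff b (1 / x) \<ge> 1"
    using clog_digits[OF b, of c a "1 / x"] by auto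
qed

lemma clog_log_term_nonneg:
  assumes b: "b \<ge> 2" and x: "0 < x" "x < 1"
  shows "clog_log_term b x \<ge> 0"
  using clog_digits_tail[OF assms] b unfolding clog_log_term_def
  by (intro add_nonneg_nonneg mult_nonneg_nonneg ln_ge_zero) auto

text \<open>The integral is the invariant measure of the cylinder with digits a and c. Up to a
  constant the antiderivative is ln (1 + x) - ln (1 + x / b), and dividing by b carries the end
  points of the cylinder to those for a + 1; this produces the difference in a.\<close>

lemma nn_integral_clog_density_branch:
  fixes c a :: nat
  assumes b: "b \<ge> 2" and c: "c \<in> {1..<b}"
  defines "D \<equiv> \<lambda>a. ln (1 + 1 / (real b ^ a * real c)) - ln (1 + 1 / (real b ^ a * real (Suc c)))"
  shows "(\<integral>\<^sup>+t. ennreal (clog_density b (clog_branch b a c t)) * ennreal (clog_jac b a c t) * indicator {0<..<1} t \<partial>lborel)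
      = ennreal (D a - D (Suc a))"
    and "D a - D (Suc a) \<ge> 0"
proof -
  define q where "q = real b ^ a"
  have q: "q > 0" using b by (simp add: q_def)
  have c1: "real c \<ge> 1" using c by simp
  define l where "l = 1 / (q * (real c + 1))"
  define r where "r = 1 / (q * real c)"
  have lr: "0 < l" "l \<le> r" using q c1 by (auto simp: l_def r_def intro!: divide_left_mono mult_left_mono mult_pos_pos)
  have F: "ln (1 + x) - ln (real b + x) = ln (1 + x) - ln (1 + x / real b) - ln (real b)" if "x > 0" for x
  proof -
    have "real b + x = real b * (1 + x / real b)" using b by (simp add: field_simps)
    moreover have "1 + x / real b > 0" using that b by (intro add_pos_nonneg) auto
    ultimately show ?thesis using b by (simp add: ln_mult)
  qed
  have diff: "(ln (1 + r) - ln (real b + r)) - (ln (1 + l) - ln (real b + l)) = D a - D (Suc a)"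
  proof -
    have "D a - D (Suc a) = (ln (1 + r) - ln (1 + l)) - (ln (1 + r / real b) - ln (1 + l / real b))"
      by (simp add: D_def l_def r_def q_def mult_ac add.commute)
    then show ?thesis using F[of r] F[of l] lr by linarith
  qed
  have "(\<integral>\<^sup>+t. ennreal (clog_density b (clog_branch b a c t)) * ennreal (clog_jac b a c t) * indicator {0<..<1} t \<partial>lborel)
      = (\<integral>\<^sup>+x. ennreal (clog_density b x) * indicator {l<..r} x \<partial>lborel)"
    unfolding l_def r_def q_def by (rule nn_integral_clog_branch[OF b c, symmetric]) measurable
  also have "\<dots> = (\<integral>\<^sup>+x. ennreal (clog_density b x) * indicator {l..r} x \<partial>lborel)"
  proof (rule nn_integral_cong_AE)
    have "AE x in lborel. x \<noteq> l" by (rule AE_lborel_singleton)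
    then show "AE x in lborel. ennreal (clog_density b x) * indicator {l<..r} x = ennreal (clog_density b x) * indicator {l..r} x"
      by eventually_elim (auto simp: indicator_def)
  qed
  also have "\<dots> = ennreal ((ln (1 + r) - ln (real b + r)) - (ln (1 + l) - ln (real b + l)))"
    using lr by (intro nn_integral_FTC_Icc clog_antiderivative[OF b] clog_density_nonneg[OF b]) auto
  finally show "(\<integral>\<^sup>+t. ennreal (clog_density b (clog_branch b a c t)) * ennreal (clog_jac b a c t) * indicator {0<..<1} t \<partial>lborel)
      = ennreal (D a - D (Suc a))" by (simp only: diff)
  have "ln (1 + l) - ln (real b + l) \<le> ln (1 + r) - ln (real b + r)"
  proof (rule DERIV_nonneg_imp_nondecreasing[OF lr(2)])
    fix x assume "l \<le> x" "x \<le> r"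
    then show "\<exists>y. ((\<lambda>x. ln (1 + x) - ln (real b + x)) has_real_derivative y) (at x) \<and> 0 \<le> y"
      using lr clog_antiderivative[OF b, of x] clog_density_nonneg[OF b, of x] by auto
  qed
  then show "D a - D (Suc a) \<ge> 0" using diff by linarith
qed

text \<open>Abel summation: ln (1 - 1 / l) is the increment ln (l - 1) - ln l. The boundary term at
  1 vanishes because ln 1 = 0, and the one at b is the summand with ln b on the left.\<close>

lemma clog_sum_by_parts:
  assumes "b \<ge> 1"
  shows "(\<Sum>c\<in>{1..<b}. ln (real c) * (ln (1 + 1 / real c) - ln (1 + 1 / real (Suc c)))) + ln (real b) * ln (1 + 1 / real b)
    = - (\<Sum>l = 2..b. ln (1 - 1 / real l) * ln (1 + 1 / real l))"
  using assms
proof (induction b rule: dec_induct)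
  case (step n)
  have "ln (1 - 1 / real (Suc n)) = ln (real n / real (Suc n))" using step by (simp add: field_simps)
  also have "\<dots> = ln (real n) - ln (real (Suc n))" using step by (subst ln_div) auto
  finally have "ln (1 - 1 / real (Suc n)) = ln (real n) - ln (real (Suc n))" .
  then have "(\<Sum>l = 2..Suc n. ln (1 - 1 / real l) * ln (1 + 1 / real l)) =
      (\<Sum>l = 2..n. ln (1 - 1 / real l) * ln (1 + 1 / real l)) + (ln (real n) - ln (real (Suc n))) * ln (1 + 1 / real (Suc n))"
    using step by (simp del: of_nat_Suc)
  then show ?case using step by (simp add: algebra_simps del: of_nat_Suc)
qed simp

text \<open>The part with ln c telescopes in a. In the part with a ln b the sum over c collapses
  first, because \<open>v a b\<close> equals \<open>v (Suc a) 1\<close>; what is left is a times a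
  second difference of \<open>v a 1\<close>, whose series equals \<open>v 1 1\<close> = ln (1 + 1 /
  b). This is the boundary term that \<open>clog_sum_by_parts\<close> absorbs.\<close>

lemma clog_expectation_sums:
  assumes b: "b \<ge> 2"
  defines "v \<equiv> \<lambda>a c. ln (1 + 1 / (real b ^ a * real c))"
  defines "D \<equiv> \<lambda>c a. v a c - v a (Suc c)"
  shows "(\<lambda>a. \<Sum>c\<in>{1..<b}. (ln (real c) + real a * ln (real b)) * (D c a - D c (Suc a))) sums
    - (\<Sum>l = 2..b. ln (1 - 1 / real l) * ln (1 + 1 / real l))"
proof -
  have sum_D: "(\<Sum>c\<in>{1..<b}. D c a) = v a 1 - v (Suc a) 1" for a
  proof -
    have "(\<Sum>c\<in>{1..<b}. D c a) = v a 1 - v a b"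
      using sum_Suc_diff'[of 1 b "\<lambda>c. - v a c"] b by (simp add: D_def)
    also have "v a b = v (Suc a) 1" by (simp add: v_def mult.commute)
    finally show ?thesis .
  qed
  \<comment> \<open>Summation by parts of a (e a - e (a + 1)) with e a =
    \<open>v a 1 - v (Suc a) 1\<close>.\<close>
  have partial: "(\<Sum>a<N. \<Sum>c\<in>{1..<b}. (ln (real c) + real a * ln (real b)) * (D c a - D c (Suc a))) =
    (\<Sum>c\<in>{1..<b}. ln (real c) * (D c 0 - D c N)) +
      ln (real b) * (v 1 1 - v (Suc N) 1 - real N * (v N 1 - v (Suc N) 1))" for N
  proof (induction N)
    case (Suc N)
    have "(\<Sum>c\<in>{1..<b}. (ln (real c) + real N * ln (real b)) * (D c N - D c (Suc N))) =
      (\<Sum>c\<in>{1..<b}. ln (real c) * (D c N - D c (Suc N))) + real N * ln (real b) * ((\<Sum>c\<in>{1..<b}. D c N) - (\<Sum>c\<in>{1..<b}. D c (Suc N)))"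
      by (simp add: algebra_simps sum.distrib sum_subtractf sum_distrib_left)
    also have "\<dots> = (\<Sum>c\<in>{1..<b}. ln (real c) * (D c N - D c (Suc N))) +
        real N * ln (real b) * (v N 1 - 2 * v (Suc N) 1 + v (Suc (Suc N)) 1)"
      by (simp only: sum_D) (simp add: algebra_simps)
    finally have step: "(\<Sum>c\<in>{1..<b}. (ln (real c) + real N * ln (real b)) * (D c N - D c (Suc N))) = \<dots>" .
    have "(\<Sum>c\<in>{1..<b}. ln (real c) * (D c 0 - D c N)) + (\<Sum>c\<in>{1..<b}. ln (real c) * (D c N - D c (Suc N)))
      = (\<Sum>c\<in>{1..<b}. ln (real c) * (D c 0 - D c (Suc N)))"
      by (simp add: sum.distrib[symmetric] algebra_simps)
    then show ?case
      unfolding sum.lessThan_Suc Suc.IH step by (simp add: algebra_simps)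
  qed simp
  have v_le: "v a c \<le> (1 / real b) ^ a" "v a c \<ge> 0" if "c \<ge> 1" for a c
  proof -
    have pos: "real b ^ a * real c > 0" using b that by simp
    have "v a c \<le> 1 / (real b ^ a * real c)" using pos unfolding v_def
      by (intro ln_add_one_self_le_self) auto
    also have "\<dots> \<le> 1 / (real b ^ a * 1)" using pos b that by (intro divide_left_mono mult_left_mono) auto
    finally show "v a c \<le> (1 / real b) ^ a" by (simp add: power_one_over)
    show "v a c \<ge> 0" using pos unfolding v_def by (intro ln_ge_zero) auto
  qed
  have v_lim: "(\<lambda>a. v a c) \<longlonglongrightarrow> 0" if "c \<ge> 1" for c
  proof (rule tendsto_sandwich[OF _ _ tendsto_const])
    show "(\<lambda>a. (1 / real b) ^ a) \<longlonglongrightarrow> 0" using b by (intro LIMSEQ_realpow_zero) auto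
  qed (use v_le that in auto)
  \<comment> \<open>The factor N left by summation by parts is harmless, since \<open>v N 1\<close>
    lies between 0 and b^(-N).\<close>
  have Nv_lim: "(\<lambda>N. real N * (v N 1 - v (Suc N) 1)) \<longlonglongrightarrow> 0"
  proof (rule tendsto_sandwich[where f = "\<lambda>N. - (1 / real b) * (real N * (1 / real b) ^ N)" and h = "\<lambda>N. real N * (1 / real b) ^ N"])
    have *: "(\<lambda>N. real N * (1 / real b) ^ N) \<longlonglongrightarrow> 0"
      using powser_times_n_limit_0[of "1 / real b"] b by simp
    then show "(\<lambda>N. real N * (1 / real b) ^ N) \<longlonglongrightarrow> 0" .
    have "(\<lambda>N. - (1 / real b) * (real N * (1 / real b) ^ N)) \<longlonglongrightarrow> - (1 / real b) * 0"
      by (intro tendsto_mult_left *)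
    then show "(\<lambda>N. - (1 / real b) * (real N * (1 / real b) ^ N)) \<longlonglongrightarrow> 0" by simp
    show "\<forall>\<^sub>F N in sequentially. real N * (v N 1 - v (Suc N) 1) \<le> real N * (1 / real b) ^ N"
    proof (intro always_eventually allI)
      fix N
      have "v N 1 - v (Suc N) 1 \<le> (1 / real b) ^ N" using v_le(1)[of 1 N] v_le(2)[of 1 "Suc N"] by linarith
      then show "real N * (v N 1 - v (Suc N) 1) \<le> real N * (1 / real b) ^ N" by (intro mult_left_mono) auto
    qed
    show "\<forall>\<^sub>F N in sequentially. - (1 / real b) * (real N * (1 / real b) ^ N) \<le> real N * (v N 1 - v (Suc N) 1)"
    proof (intro always_eventually allI)
      fix N
      have "real N * (- ((1 / real b) ^ Suc N)) \<le> real N * (v N 1 - v (Suc N) 1)"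
        using v_le(2)[of 1 N] v_le(1)[of 1 "Suc N"] by (intro mult_left_mono) linarith+
      then show "- (1 / real b) * (real N * (1 / real b) ^ N) \<le> real N * (v N 1 - v (Suc N) 1)"
        by (simp add: mult_ac)
    qed
  qed
  have D_lim: "D c \<longlonglongrightarrow> 0" if "c \<in> {1..<b}" for c
    using tendsto_diff[OF v_lim[of c] v_lim[of "Suc c"]] that by (simp add: D_def)
  have "(\<lambda>N. (\<Sum>c\<in>{1..<b}. ln (real c) * (D c 0 - D c N)) +
      ln (real b) * (v 1 1 - v (Suc N) 1 - real N * (v N 1 - v (Suc N) 1))) \<longlonglongrightarrow>
    (\<Sum>c\<in>{1..<b}. ln (real c) * (D c 0 - 0)) + ln (real b) * (v 1 1 - 0 - 0)"
    using v_lim[of 1] by (intro tendsto_intros D_lim Nv_lim LIMSEQ_Suc) auto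
  moreover have "(\<Sum>c\<in>{1..<b}. ln (real c) * (D c 0 - 0)) + ln (real b) * (v 1 1 - 0 - 0) =
    - (\<Sum>l = 2..b. ln (1 - 1 / real l) * ln (1 + 1 / real l))"
    using clog_sum_by_parts[of b] b by (simp add: D_def v_def)
  ultimately show ?thesis unfolding sums_def partial by simp
qed

text \<open>The logarithm is constant on each cylinder of rank one, so its integral is the sum of
  its values times the cylinder measures. All summands are nonnegative, so one computation in the
  extended reals yields both integrability and value.\<close>

lemma integral_clog_log_term:
  assumes b: "b \<ge> 2"
  defines "S \<equiv> - (\<Sum>l = 2..b. ln (1 - 1 / real l) * ln (1 + 1 / real l))"
  shows "integrable (clog_measure b) (clog_log_term b)"
    and "integral\<^sup>L (clog_measure b) (clog_log_term b) = S"
proof -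
  define D where "D c a = ln (1 + 1 / (real b ^ a * real c)) - ln (1 + 1 / (real b ^ a * real (Suc c)))" for a c
  note branch = nn_integral_clog_density_branch[OF b, folded D_def]
  have term_nonneg: "(ln (real c) + real a * ln (real b)) * (D c a - D c (Suc a)) \<ge> 0" if c: "c \<in> {1..<b}" for a c
    using branch(2)[OF c] b c by (intro mult_nonneg_nonneg add_nonneg_nonneg ln_ge_zero) auto
  have S: "(\<lambda>a. \<Sum>c\<in>{1..<b}. (ln (real c) + real a * ln (real b)) * (D c a - D c (Suc a))) sums S"
    using clog_expectation_sums[OF b] unfolding D_def S_def .
  have "(\<integral>\<^sup>+x. ennreal (clog_log_term b x) \<partial>clog_measure b) =
    (\<integral>\<^sup>+x. ennreal (clog_density b x) * ennreal (clog_log_term b x) * indicator {0<..<1} x \<partial>lborel)"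
    unfolding clog_measure_def by (subst nn_integral_density) (auto intro!: nn_integral_cong simp: mult_ac)
  also have "\<dots> = (\<Sum>c\<in>{1..<b}. \<Sum>a. \<integral>\<^sup>+t. ennreal (clog_density b (clog_branch b a c t)) * ennreal (clog_log_term b (clog_branch b a c t)) *
      ennreal (clog_jac b a c t) * indicator {0<..<1} t \<partial>lborel)"
    by (rule nn_integral_clog_branches[OF b]) measurable
  also have "\<dots> = (\<Sum>c\<in>{1..<b}. \<Sum>a. \<integral>\<^sup>+t. ennreal (ln (real c) + real a * ln (real b)) *
      (ennreal (clog_density b (clog_branch b a c t)) * ennreal (clog_jac b a c t) * indicator {0<..<1} t) \<partial>lborel)"
  proof (intro sum.cong refl suminf_cong nn_integral_cong)
    fix c a t assume c: "c \<in> {1..<b}"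
    show "ennreal (clog_density b (clog_branch b a c t)) * ennreal (clog_log_term b (clog_branch b a c t)) *
        ennreal (clog_jac b a c t) * indicator {0<..<1} t =
      ennreal (ln (real c) + real a * ln (real b)) *
        (ennreal (clog_density b (clog_branch b a c t)) * ennreal (clog_jac b a c t) * indicator {0<..<1} t)"
      using clog_log_term_branch[OF b c, of t a] by (cases "0 < t \<and> t < 1") (auto simp: mult_ac)
  qed
  also have "\<dots> = (\<Sum>c\<in>{1..<b}. \<Sum>a. ennreal ((ln (real c) + real a * ln (real b)) * (D c a - D c (Suc a))))"
  proof (intro sum.cong refl suminf_cong)
    fix c a assume c: "c \<in> {1..<b}"
    show "(\<integral>\<^sup>+t. ennreal (ln (real c) + real a * ln (real b)) *
      (ennreal (clog_density b (clog_branch b a c t)) * ennreal (clog_jac b a c t) * indicator {0<..<1} t) \<partial>lborel) =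
      ennreal ((ln (real c) + real a * ln (real b)) * (D c a - D c (Suc a)))"
      using branch[OF c, of a] b c
      by (subst nn_integral_cmult) (auto simp: ennreal_mult)
  qed
  \<comment> \<open>The sum over c moves inside the series because the cancellation in
    \<open>clog_expectation_sums\<close> joins the end c = b at level a to c = 1 at level a +
    1.\<close>
  also have "\<dots> = (\<Sum>a. \<Sum>c\<in>{1..<b}. ennreal ((ln (real c) + real a * ln (real b)) * (D c a - D c (Suc a))))"
    by (rule suminf_sum[symmetric]) simp
  also have "\<dots> = (\<Sum>a. ennreal (\<Sum>c\<in>{1..<b}. (ln (real c) + real a * ln (real b)) * (D c a - D c (Suc a))))"
    using term_nonneg by (intro suminf_cong sum_ennreal) auto
  also have "\<dots> = ennreal S"
    using S term_nonneg by (intro suminf_ennreal_eq sum_nonneg) auto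
  finally have nn: "(\<integral>\<^sup>+x. ennreal (clog_log_term b x) \<partial>clog_measure b) = ennreal S" .
  have S0: "S \<ge> 0"
    using term_nonneg by (intro sums_le[OF _ sums_zero S] sum_nonneg) auto
  have AE: "AE x in clog_measure b. 0 \<le> clog_log_term b x"
    unfolding clog_measure_def by (subst AE_density) (auto simp: indicator_def clog_log_term_nonneg[OF b] split: if_splits)
  show "integrable (clog_measure b) (clog_log_term b)"
    by (rule integrableI_nn_integral_finite[OF _ AE nn]) simp
  show "integral\<^sup>L (clog_measure b) (clog_log_term b) = S"
    by (subst integral_eq_nn_integral[OF _ AE]) (auto simp: nn S0)
qed

section \<open>The geometric mean of the terms\<close>

text \<open>The term with index 0 is 1, so y_1 = 1 / (\<alpha> - 1) and indices shift by one. The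
  identity also holds after termination, since p / (y - c p) and 1 / (y / p - c) then both divide by
  0.\<close>

lemma clog_tail_Suc:
  assumes b: "b \<ge> 2" and \<alpha>: "1 < \<alpha>" "\<alpha> < 2"
  shows "clog_tail b \<alpha> (Suc n) = 1 / (clog_map b ^^ n) (\<alpha> - 1)"
proof (induction n)
  case 0
  have "clog_exp b \<alpha> = int 0" "clog_coeff b \<alpha> = int 1"
    using clog_digits[OF b, of 1 0 \<alpha>] b \<alpha> by auto
  then show ?case by simp
next
  case (Suc n)
  let ?y = "clog_tail b \<alpha> (Suc n)"
  have "clog_tail b \<alpha> (Suc (Suc n)) = real b powi clog_exp b ?y / (?y - of_int (clog_coeff b ?y) * real b powi clog_exp b ?y)"
    by (simp only: clog_tail.simps(2)[of b \<alpha> "Suc n"] Let_def)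
  also have "p / (y - c * p) = 1 / (y / p - c)" if "p > 0" for p y c :: real
    using that by (simp add: field_simps)
  then have "real b powi clog_exp b ?y / (?y - of_int (clog_coeff b ?y) * real b powi clog_exp b ?y) =
      1 / (?y / real b powi clog_exp b ?y - of_int (clog_coeff b ?y))"
    using b by (metis of_nat_0_less_iff less_le_trans zero_less_numeral zero_less_power_int)
  also have "\<dots> = 1 / (clog_map b ^^ Suc n) (\<alpha> - 1)"
    by (simp only: Suc.IH funpow.simps(2) comp_apply clog_map_def[of b "(clog_map b ^^ n) (\<alpha> - 1)"])
  finally show ?case .
qed

lemma clog_term_Suc:
  assumes "b \<ge> 2" "1 < \<alpha>" "\<alpha> < 2" and x: "(clog_map b ^^ n) (\<alpha> - 1) \<in> {0<..<1}"
  shows "clog_term b \<alpha> (Suc n) = exp (clog_log_term b ((clog_map b ^^ n) (\<alpha> - 1)))"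
proof -
  let ?x = "(clog_map b ^^ n) (\<alpha> - 1)"
  have "clog_coeff b (1 / ?x) \<ge> 1" using clog_digits_tail(2)[of b ?x] assms by auto
  then have "exp (ln (of_int (clog_coeff b (1 / ?x)))) = (of_int (clog_coeff b (1 / ?x)) :: real)" by simp
  moreover have "exp (of_int (clog_exp b (1 / ?x)) * ln (real b)) = real b powi clog_exp b (1 / ?x)"
    using assms by (simp add: powr_real_of_int'[symmetric] powr_def)
  ultimately show ?thesis
    by (simp only: clog_term_def clog_c_def clog_a_def clog_tail_Suc[OF assms(1-3)] clog_log_term_def exp_add)
qed

text \<open>Stopping at an index n \<ge> 1 means that the next iterate of the map is 0, which lies
  outside (0,1); stopping at 0 means \<alpha> = 1.\<close>

lemma clog_not_terminates:
  assumes b: "b \<ge> 2" and \<alpha>: "1 < \<alpha>" "\<alpha> < 2" and x: "\<And>n. (clog_map b ^^ n) (\<alpha> - 1) \<in> {0<..<1}"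
  shows "\<not> clog_terminates b \<alpha>"
proof
  assume "clog_terminates b \<alpha>"
  then obtain n where n: "clog_tail b \<alpha> n = clog_term b \<alpha> n" by (auto simp: clog_terminates_def)
  show False
  proof (cases n)
    case 0
    have "clog_exp b \<alpha> = int 0" "clog_coeff b \<alpha> = int 1"
      using clog_digits[OF b, of 1 0 \<alpha>] b \<alpha> by auto
    then show ?thesis using n 0 \<alpha> by (simp add: clog_term_def clog_c_def clog_a_def)
  next
    case (Suc m)
    let ?x = "(clog_map b ^^ m) (\<alpha> - 1)"
    have "1 / ?x = of_int (clog_coeff b (1 / ?x)) * real b powi clog_exp b (1 / ?x)"
      using n unfolding Suc clog_term_def clog_c_def clog_a_def clog_tail_Suc[OF b \<alpha>] .
    moreover have "real b powi clog_exp b (1 / ?x) \<noteq> 0" using b by simp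
    ultimately have "1 / ?x / real b powi clog_exp b (1 / ?x) = of_int (clog_coeff b (1 / ?x))"
      by (metis nonzero_mult_div_cancel_right)
    then have "clog_map b ?x = 0" by (simp only: clog_map_def diff_self)
    then show ?thesis using x[of "Suc m"] by simp
  qed
qed

lemma clog_khinchine_limit:
  assumes b: "b \<ge> 2" and \<alpha>: "1 < \<alpha>" "\<alpha> < 2" and x: "\<And>n. (clog_map b ^^ n) (\<alpha> - 1) \<in> {0<..<1}"
    and lim: "(\<lambda>n. birkhoff_sum (clog_map b) (clog_log_term b) n (\<alpha> - 1) / real n) \<longlonglongrightarrow> L"
  shows "(\<lambda>N. (\<Prod>n = 1..N. clog_term b \<alpha> n) powr (1 / real N)) \<longlonglongrightarrow> exp L"
proof -
  have "(\<Prod>n = 1..N. clog_term b \<alpha> n) = exp (birkhoff_sum (clog_map b) (clog_log_term b) N (\<alpha> - 1))" for N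
  proof -
    have "(\<Prod>n = 1..N. clog_term b \<alpha> n) = (\<Prod>n<N. clog_term b \<alpha> (Suc n))"
      by (rule prod.reindex_bij_witness[of _ Suc "\<lambda>n. n - 1"]) auto
    also have "\<dots> = exp (birkhoff_sum (clog_map b) (clog_log_term b) N (\<alpha> - 1))"
      using clog_term_Suc[OF b \<alpha> x] by (simp add: birkhoff_sum_def exp_sum)
    finally show ?thesis .
  qed
  then show ?thesis using tendsto_exp[OF lim] by (simp add: powr_def)
qed

text \<open>Integral and mass carry a minus sign each, and these cancel in the quotient;
  \<open>powr\<close> supplies the ln b that cancels the one in the denominator of the
  exponent.\<close>

lemma powr_clog_khinchine_exponent:
  assumes b: "b \<ge> 2"
  shows "real b powr clog_khinchine_exponent b = exp (integral\<^sup>L (clog_measure b) (clog_log_term b) /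
    measure (clog_measure b) (space (clog_measure b)))"
proof -
  define S where "S = (\<Sum>l = 2..b. ln (1 - 1 / real l) * ln (1 + 1 / real l))"
  have "2 * real b / (real b + 1) \<ge> 1" using b by simp
  then have "measure (clog_measure b) (space (clog_measure b)) = ln (2 * real b / (real b + 1))"
    using emeasure_clog_measure_UNIV[OF b] by (simp add: measure_def)
  also have "\<dots> = - ln ((real b + 1) / (2 * real b))" using b by (simp add: ln_div)
  finally have mass: "measure (clog_measure b) (space (clog_measure b)) = - ln ((real b + 1) / (2 * real b))" .
  have "ln (real b) > 0" using b by simp
  then have "clog_khinchine_exponent b * ln (real b) = S / ln ((real b + 1) / (2 * real b))"
    by (simp add: clog_khinchine_exponent_def S_def)
  then show ?thesis using b integral_clog_log_term(2)[OF b] mass by (simp add: powr_def S_def)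
qed

theorem theorem23:
  fixes b :: nat
  assumes "b \<ge> 2"
  shows "AE \<alpha> in lebesgue. \<alpha> \<in> {1<..<2} \<longrightarrow>
    \<not> clog_terminates b \<alpha> \<and>
    (\<lambda>N. (\<Prod>n = 1..N. clog_term b \<alpha> n) powr (1 / real N))
      \<longlonglongrightarrow> real b powr clog_khinchine_exponent b"
proof -
  note b = assms
  interpret ergodic_system "clog_measure b" "clog_map b" by (rule ergodic_clog_map[OF b])
  define L where "L = integral\<^sup>L (clog_measure b) (clog_log_term b) / measure (clog_measure b) (space (clog_measure b))"
  have mass: "emeasure (clog_measure b) (space (clog_measure b)) = ennreal (ln (2 * real b / (real b + 1)))"
    using emeasure_clog_measure_UNIV[OF b] by simp
  have "2 * real b / (real b + 1) > 1" using b by simp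
  then have ln_pos: "ln (2 * real b / (real b + 1)) > 0" by (rule ln_gt_zero)
  have "AE x in clog_measure b. (\<lambda>n. birkhoff_sum (clog_map b) (clog_log_term b) n x / real n) \<longlonglongrightarrow> L"
    unfolding L_def
  proof (rule birkhoff[OF _ _ integral_clog_log_term(1)[OF b]])
    show "finite_measure (clog_measure b)" using mass by (intro finite_measureI) simp
    show "measure (clog_measure b) (space (clog_measure b)) > 0" using mass ln_pos by (simp add: measure_def)
  qed
  moreover have "AE x in clog_measure b. x \<in> {0<..<1}"
    unfolding clog_measure_def by (subst AE_density) (auto simp: indicator_def split: if_splits)
  then have "AE x in clog_measure b. \<forall>n. (clog_map b ^^ n) x \<in> {0<..<1}"
    unfolding AE_all_countable by (intro allI AE_funpow)
  ultimately have "AE x in clog_measure b. (\<forall>n. (clog_map b ^^ n) x \<in> {0<..<1}) \<and>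
      (\<lambda>n. birkhoff_sum (clog_map b) (clog_log_term b) n x / real n) \<longlonglongrightarrow> L" (is "AE x in _. ?P x")
    by eventually_elim simp
  \<comment> \<open>A Borel null set around the exceptional points makes the property measurable, as
    the affine change of variable below requires.\<close>
  then obtain N where N: "{x \<in> space (clog_measure b). \<not> ?P x} \<subseteq> N" "N \<in> null_sets (clog_measure b)"
    unfolding eventually_ae_filter by blast
  then have [measurable]: "N \<in> sets borel" by (auto simp: null_sets_def)
  have "AE x in clog_measure b. x \<notin> N" using N(2) by (rule AE_not_in)
  \<comment> \<open>The density is positive on (0,1), so null sets of the invariant measure are
    Lebesgue null there.\<close>
  then have "AE x in lborel. 0 < x \<and> x < 1 \<longrightarrow> x \<notin> N"
    unfolding clog_measure_def
    by (subst (asm) AE_density) (auto elim!: eventually_mono simp: clog_density_pos[OF b] indicator_def)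
  then have "AE x in lborel. 0 < -1 + 1 * x \<and> -1 + 1 * x < 1 \<longrightarrow> -1 + 1 * x \<notin> N"
    by (intro AE_borel_affine[where P = "\<lambda>x. 0 < x \<and> x < 1 \<longrightarrow> x \<notin> N"]) auto
  then have "AE \<alpha> in lborel. \<alpha> \<in> {1<..<2} \<longrightarrow> \<not> clog_terminates b \<alpha> \<and>
    (\<lambda>N. (\<Prod>n = 1..N. clog_term b \<alpha> n) powr (1 / real N)) \<longlonglongrightarrow> real b powr clog_khinchine_exponent b"
  proof eventually_elim
    case (elim \<alpha>)
    show ?case
    proof
      assume \<alpha>: "\<alpha> \<in> {1<..<2}"
      then have "\<alpha> - 1 \<notin> N" using elim by (simp add: add.commute)
      then have "?P (\<alpha> - 1)" using N(1) by auto
      then show "\<not> clog_terminates b \<alpha> \<and>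
          (\<lambda>N. (\<Prod>n = 1..N. clog_term b \<alpha> n) powr (1 / real N)) \<longlonglongrightarrow> real b powr clog_khinchine_exponent b"
        using clog_not_terminates[OF b, of \<alpha>] clog_khinchine_limit[OF b, of \<alpha> L] \<alpha>
        by (simp add: powr_clog_khinchine_exponent[OF b] L_def)
    qed
  qed
  then show ?thesis by (rule AE_completion)
qed

end
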